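(* Assume $1 \leq p \leq \infty$ and $m \in \mathbb{N}$, and let $\frac1p+\frac1q=1$. Take $\phi \in L^q(\mathbb{R}^d)$ with $P|\phi| \in L^\infty(\mathbb{R}^d)$. Fix $j>0$, and assume $b=I$. Then $T_j : W^{m,p}(\mathbb{R}^d) \to w^{m,p}$, with norm controlled by the estimate $$\sum_{|\rho| \leq m} |\alpha_j|^{|\rho|} \| \Delta^\rho T_j f \|_{\ell^p} \leq \| P|\phi| \|_\infty \| f \|_{W^{m,p}} , \qquad f \in W^{m,p} .$$
   Context: Fix $d\in\mathbb{N}$. The dilation matrices are isotropic and expanding: $a_j=\alpha_j I$ ($j=1,2,3,\ldots$), where $\alpha_j$ are nonzero real numbers with $|\alpha_j|\to\infty$ as $j\to\infty$. The translation matrix is $b=I$. Functions are complex-valued; $1/\infty=0$. For $\phi\in L^q$, $\phi_{j,k}(x)=|\det a_j|^{1/q}\phi(a_jx-k)$ for $k\in\mathbb{Z}^d$, and $\langle f,\phi_{j,k}\rangle=\int_{\mathbb{R}^d}f\,\overline{\phi_{j,k}}\,dx$. The analysis operator at scale $j$ is $T_jf=\{\langle f,\phi_{j,k}\rangle\}_{k\in\mathbb{Z}^d}$. The periodization is $Pf(x)=\sum_{k\in\mathbb{Z}^d}f(x-k)$. $W^{m,p}=W^{m,p}(\mathbb{R}^d)$ is the Sobolev space of functions with $m$ derivatives in $L^p$, normed by $\|f\|_{W^{m,p}}=\sum_{|\rho|\le m}\|D^\rho f\|_p$ ($\rho$ multiindices). For sequences $s=\{s_k\}_{k\in\mathbb{Z}^d}$,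 $\Delta_ts=\{s_k-s_{k-e_t}\}_{k\in\mathbb{Z}^d}$, $t=1,\ldots,d$, with $e_t$ the $t$-th coordinate unit vector, and $\Delta^\rho=\Delta_1^{\rho_1}\cdots\Delta_d^{\rho_d}$. The discrete Sobolev space is $w^{m,p}=\{s\in\ell^p(\mathbb{Z}^d):\Delta^\rho s\in\ell^p \text{ for all } |\rho|\le m\}$ with norm $\|s\|_{w^{m,p}}=\sum_{|\rho|\le m}\|\Delta^\rho s\|_{\ell^p}$. *)

theory Defs
  imports "HOL-Probability.Essential_Supremum"
begin

text \<open>
  The \<open>d\<close>-dimensional space is \<^typ>\<open>real^'n\<close>, its integer lattice is \<^typ>\<open>int^'n\<close>. The
  coordinates form a linear order so that products over the coordinates, such as
  \<open>\<Delta>\<^sub>1\<^bsup>\<rho>\<^sub>1\<^esup> \<dots> \<Delta>\<^sub>d\<^bsup>\<rho>\<^sub>d\<^esup>\<close>, can be taken in a definite order without knowing beforehand that the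
  factors commute. A multiindex is a function \<open>\<rho> :: 'n \<Rightarrow> nat\<close>.
\<close>

definition multi_order :: "('n::finite \<Rightarrow> nat) \<Rightarrow> nat"
  where "multi_order \<rho> = (\<Sum>i\<in>UNIV. \<rho> i)"

definition multi_power ::
    "('n::{finite,linorder} \<Rightarrow> 'a \<Rightarrow> 'a) \<Rightarrow> ('n \<Rightarrow> nat) \<Rightarrow> 'a \<Rightarrow> 'a"
  where "multi_power A \<rho> = foldr (\<lambda>i B. (A i ^^ \<rho> i) \<circ> B) (sorted_list_of_set UNIV) id"


subsection \<open>Lebesgue spaces\<close>

text \<open>
  Norms take values in \<open>[0,\<infinity>]\<close>, so that no finite default value is attached to functions
  outside the space. Functions are taken pointwise, not modulo null sets.
  The sequence spaces are the case of the counting measure.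
\<close>

definition Lp_norm :: "ennreal \<Rightarrow> 'a measure \<Rightarrow> ('a \<Rightarrow> complex) \<Rightarrow> ennreal"
  where "Lp_norm p M f =
    (if p = \<infinity> then esssup M (\<lambda>x. ennreal (norm (f x)))
     else let I = (\<integral>\<^sup>+x. ennreal (norm (f x) powr enn2real p) \<partial>M)
          in if I = \<infinity> then \<infinity> else ennreal (enn2real I powr (1 / enn2real p)))"

definition Lp_space :: "ennreal \<Rightarrow> 'a measure \<Rightarrow> ('a \<Rightarrow> complex) set"
  where "Lp_space p M = {f. f \<in> borel_measurable M \<and> Lp_norm p M f < \<infinity>}"


subsection \<open>Weak derivatives and Sobolev spaces\<close>

definition partial_deriv ::
    "'n::finite \<Rightarrow> (real^'n::_ \<Rightarrow> complex) \<Rightarrow> real^'n::_ \<Rightarrow> complex"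
  where "partial_deriv i f x = vector_derivative (\<lambda>t. f (x + t *\<^sub>R axis i 1)) (at 0)"

definition smooth :: "(real^'n::finite \<Rightarrow> complex) \<Rightarrow> bool"
  where "smooth f \<longleftrightarrow>
    (\<forall>is. continuous_on UNIV (foldr partial_deriv is f) \<and>
          (\<forall>i x. (\<lambda>t::real. foldr partial_deriv is f (x + t *\<^sub>R axis i 1)) differentiable (at 0)))"

definition test_function :: "(real^'n::finite \<Rightarrow> complex) \<Rightarrow> bool"
  where "test_function \<psi> \<longleftrightarrow> smooth \<psi> \<and> compact (closure (support_on UNIV \<psi>))"

definition locally_integrable :: "(real^'n::finite \<Rightarrow> complex) \<Rightarrow> bool"
  where "locally_integrable f \<longleftrightarrow> (\<forall>K. compact K \<longrightarrow> f absolutely_integrable_on K)"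

definition has_weak_deriv ::
    "(real^'n::{finite,linorder} \<Rightarrow> complex) \<Rightarrow> ('n \<Rightarrow> nat) \<Rightarrow> (real^'n::_ \<Rightarrow> complex) \<Rightarrow> bool"
  where "has_weak_deriv f \<rho> g \<longleftrightarrow>
    locally_integrable f \<and> locally_integrable g \<and>
    (\<forall>\<psi>. test_function \<psi> \<longrightarrow>
      (LINT x|lebesgue. f x * multi_power partial_deriv \<rho> \<psi> x) =
      (-1) ^ multi_order \<rho> * (LINT x|lebesgue. g x * \<psi> x))"

text \<open>
  The choice below is unique up to null sets, hence irrelevant for norms and for membership
  in a Lebesgue space.
\<close>

definition weak_deriv ::
    "('n::{finite,linorder} \<Rightarrow> nat) \<Rightarrow> (real^'n::_ \<Rightarrow> complex) \<Rightarrow> real^'n::_ \<Rightarrow> complex"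
  where "weak_deriv \<rho> f = (SOME g. has_weak_deriv f \<rho> g)"

definition sobolev_space ::
    "nat \<Rightarrow> ennreal \<Rightarrow> (real^'n::{finite,linorder} \<Rightarrow> complex) set"
  where "sobolev_space m p =
    {f \<in> Lp_space p lebesgue.
       \<forall>\<rho>. multi_order \<rho> \<le> m \<longrightarrow>
         (\<exists>g. has_weak_deriv f \<rho> g) \<and> weak_deriv \<rho> f \<in> Lp_space p lebesgue}"

definition sobolev_norm ::
    "nat \<Rightarrow> ennreal \<Rightarrow> (real^'n::{finite,linorder} \<Rightarrow> complex) \<Rightarrow> ennreal"
  where "sobolev_norm m p f =
    (\<Sum>\<rho> | multi_order \<rho> \<le> m. Lp_norm p lebesgue (weak_deriv \<rho> f))"


subsection \<open>Discrete Sobolev spaces\<close>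

definition seq_diff ::
    "'n::finite \<Rightarrow> (int^'n::_ \<Rightarrow> complex) \<Rightarrow> int^'n::_ \<Rightarrow> complex"
  where "seq_diff t s k = s k - s (k - axis t 1)"

definition discrete_sobolev_space ::
    "nat \<Rightarrow> ennreal \<Rightarrow> (int^'n::{finite,linorder} \<Rightarrow> complex) set"
  where "discrete_sobolev_space m p =
    {s \<in> Lp_space p (count_space UNIV).
       \<forall>\<rho>. multi_order \<rho> \<le> m \<longrightarrow>
         multi_power seq_diff \<rho> s \<in> Lp_space p (count_space UNIV)}"


subsection \<open>Periodization and the analysis operator\<close>

definition lattice_point :: "int^'n::_ \<Rightarrow> real^'n::finite"
  where "lattice_point k = (\<chi> i. real_of_int (k $ i))"

text \<open>
  For \<open>P|\<phi>|\<close> the periodization is used with values in \<^typ>\<open>ennreal\<close>, where the sum always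
  exists and a divergent sum has the value \<open>\<infinity>\<close>.
\<close>

definition periodization ::
    "(real^'n::finite \<Rightarrow> 'b::{comm_monoid_add,t2_space}) \<Rightarrow> real^'n::_ \<Rightarrow> 'b"
  where "periodization f x = (\<Sum>\<^sub>\<infinity>k\<in>UNIV. f (x - lattice_point k))"

definition dilate_translate ::
    "ennreal \<Rightarrow> real^'n^'n::_ \<Rightarrow> (real^'n::finite \<Rightarrow> complex) \<Rightarrow> int^'n::_ \<Rightarrow> real^'n::_ \<Rightarrow> complex"
  where "dilate_translate q a \<phi> k x =
    complex_of_real (\<bar>det a\<bar> powr enn2real (1 / q)) * \<phi> (a *v x - lattice_point k)"

definition analysis_operator ::
    "ennreal \<Rightarrow> real^'n^'n::_ \<Rightarrow> (real^'n::finite \<Rightarrow> complex) \<Rightarrow>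
     (real^'n::_ \<Rightarrow> complex) \<Rightarrow> int^'n::_ \<Rightarrow> complex"
  where "analysis_operator q a \<phi> f k =
    (LINT x|lebesgue. f x * cnj (dilate_translate q a \<phi> k x))"

end

theory Submission
  imports Defs
begin

text \<open>
  A difference \<open>\<Delta>\<^sup>\<rho> T f\<close> is \<open>T\<close> applied to the iterated difference of \<open>f\<close> with step \<open>1/\<alpha>\<close>. Moving
  differences onto a test function and using the fundamental theorem of calculus there, that
  iterated difference is found to be \<open>\<alpha>\<^bsup>-|\<rho>|\<^esup>\<close> times an iterated average of the weak derivative
  \<open>D\<^sup>\<rho> f\<close> over segments of length \<open>1/\<bar>\<alpha>\<bar>\<close>. Averages do not increase Lebesgue norms. It remains to
  bound \<open>T\<close> itself from \<open>L\<^sup>p\<close> to \<open>\<ell>\<^sup>p\<close>, which is Jensen's inequality for the weights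
  \<open>\<bar>\<phi> (\<alpha> x - k)\<bar>\<close>: their sum over \<open>k\<close> is at most \<open>\<parallel>P\<bar>\<phi>\<bar>\<parallel>\<^sub>\<infinity>\<close>, and so is \<open>\<bar>\<alpha>\<bar>\<^sup>d\<close> times their integral over \<open>x\<close>.
\<close>

text \<open>A weak derivative is known only through its pairings, and \<open>sobolev_space\<close>
  does not say how D^\<rho> f arises from derivatives of lower order. Hence all |\<rho>| differences
  are moved at once, only the weak derivative of the full order \<rho> enters, and every regularity
  question falls on smooth functions. The price is the way back: functions with equal pairings must
  be shown to agree almost everywhere, which calls for explicit bump functions.

  The step 1/\<alpha> comes from \<alpha> (x + e_t/\<alpha>) - k = \<alpha> x - (k - e_t): moving x
  by e_t/\<alpha> moves the index by e_t. The weight |\<alpha>|^|\<rho>| in the estimate undoes the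
  resulting factor, so every \<rho> gets the same constant and the sum over \<rho> is taken last.

  A second obstacle is measurability. Members of the spaces are Lebesgue measurable, whereas Fubini
  is applied to maps such as (x, s) -> f (x - s h e_t) with f Borel. Therefore f, \<phi> and
  D^\<rho> f are exchanged for Borel representatives, and the central identity holds almost
  everywhere only.\<close>

definition index_list :: "('n::{finite,linorder} \<Rightarrow> nat) \<Rightarrow> 'n list"
  where "index_list \<rho> = concat (map (\<lambda>i. replicate (\<rho> i) i) (sorted_list_of_set UNIV))"

lemma length_index_list: "length (index_list \<rho>) = multi_order \<rho>"
  by (simp add: index_list_def multi_order_def length_concat o_def sum_list_distinct_conv_sum_set)

text \<open>With a multiindex written as a list of coordinates, inductions over \<rho> peel off one
  first-order operator at a time. The same list drives \<open>partial_deriv\<close>,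
  \<open>seq_diff\<close> and the step operators below.\<close>

lemma multi_power_eq_foldr: "multi_power A \<rho> = foldr A (index_list \<rho>)"
proof -
  have rep: "foldr A (replicate n i) x = (A i ^^ n) x" for n i x
    by (induction n) auto
  have "foldr (\<lambda>i B. (A i ^^ \<rho> i) \<circ> B) xs id = foldr A (concat (map (\<lambda>i. replicate (\<rho> i) i) xs))" for xs
    by (induction xs) (auto simp: rep fun_eq_iff)
  then show ?thesis
    by (simp add: multi_power_def index_list_def)
qed


section \<open>Smooth functions\<close>

text \<open>A coinduction principle: \<open>smooth\<close> quantifies over all iterated derivatives,
  and a class stable under differentiation avoids formulas of every order. Each smoothness proof
  below amounts to the choice of \<open>S\<close>.\<close>

lemma smoothI:
  assumes "f \<in> S" "\<And>g. g \<in> S \<Longrightarrow> continuous_on UNIV g"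
    "\<And>g i. g \<in> S \<Longrightarrow> partial_deriv i g \<in> S"
    "\<And>g i x. g \<in> S \<Longrightarrow> (\<lambda>t::real. g (x + t *\<^sub>R axis i 1)) differentiable (at 0)"
  shows "smooth f"
proof -
  have "foldr partial_deriv is f \<in> S" for "is"
    by (induction "is") (auto simp: assms)
  then show ?thesis
    using assms by (auto simp: smooth_def)
qed

lemma smooth_continuous: "smooth f \<Longrightarrow> continuous_on UNIV f"
  by (metis foldr.simps(1) id_apply smooth_def)

lemma smooth_partial_deriv: "smooth f \<Longrightarrow> smooth (partial_deriv i f)"
  unfolding smooth_def
proof (intro allI conjI)
  fix xs :: "'a list" and k x
  assume *: "\<forall>is. continuous_on UNIV (foldr partial_deriv is f) \<and>
          (\<forall>i x. (\<lambda>t::real. foldr partial_deriv is f (x + t *\<^sub>R axis i 1)) differentiable (at 0))"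
  show "continuous_on UNIV (foldr partial_deriv xs (partial_deriv i f))"
    "(\<lambda>t::real. foldr partial_deriv xs (partial_deriv i f) (x + t *\<^sub>R axis k 1)) differentiable (at 0)"
    using *[rule_format, of "xs @ [i]"] by simp_all
qed

lemma smooth_foldr_partial_deriv: "smooth f \<Longrightarrow> smooth (foldr partial_deriv L f)"
  by (induction L) (auto intro: smooth_partial_deriv)

text \<open>\<open>smooth\<close> speaks of differentiability along a line at parameter 0 only.
  Moving the base point along the line gives every parameter s, as the fundamental theorem of
  calculus requires.\<close>

lemma smooth_has_partial_deriv:
  assumes "smooth f"
  shows "((\<lambda>t. f (x + t *\<^sub>R axis i 1)) has_vector_derivative partial_deriv i f (x + s *\<^sub>R axis i 1)) (at s)"
proof -
  have "(\<lambda>t::real. f ((x + s *\<^sub>R axis i 1) + t *\<^sub>R axis i 1)) differentiable (at 0)"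
    using assms unfolding smooth_def by (metis foldr.simps(1) id_apply)
  then have "((\<lambda>t::real. f ((x + s *\<^sub>R axis i 1) + t *\<^sub>R axis i 1)) has_vector_derivative
      partial_deriv i f (x + s *\<^sub>R axis i 1)) (at 0)"
    unfolding partial_deriv_def vector_derivative_works[symmetric] .
  then have "((\<lambda>t::real. f ((x + s *\<^sub>R axis i 1) + t *\<^sub>R axis i 1)) has_vector_derivative
      partial_deriv i f (x + s *\<^sub>R axis i 1)) (at (s - s) )" by simp
  then have "(((\<lambda>t::real. f ((x + s *\<^sub>R axis i 1) + t *\<^sub>R axis i 1)) \<circ> (\<lambda>t. t - s)) has_vector_derivative
      (1::real) *\<^sub>R partial_deriv i f (x + s *\<^sub>R axis i 1)) (at s)"
    by (intro vector_diff_chain_at) (auto intro!: derivative_eq_intros)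
  then show ?thesis
    by (simp add: o_def algebra_simps)
qed

lemma partial_derivI:
  "((\<lambda>t. f (x + t *\<^sub>R axis i 1)) has_vector_derivative D) (at 0) \<Longrightarrow> partial_deriv i f x = D"
  unfolding partial_deriv_def by (rule vector_derivative_at)

lemma smooth_has_partial_deriv_0:
  "smooth f \<Longrightarrow> ((\<lambda>t. f (x + t *\<^sub>R axis i 1)) has_vector_derivative partial_deriv i f x) (at 0)"
  using smooth_has_partial_deriv[of f x i 0] by simp

text \<open>Closed under partial derivatives by the product rule, hence consisting of smooth functions.\<close>

inductive_set product_sums :: "(real^'n::finite \<Rightarrow> complex) set"
  where prod: "smooth f \<Longrightarrow> smooth g \<Longrightarrow> (\<lambda>x. f x * g x) \<in> product_sums"
  | add: "u \<in> product_sums \<Longrightarrow> v \<in> product_sums \<Longrightarrow> (\<lambda>x. u x + v x) \<in> product_sums"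

lemma product_sums_partial_deriv:
  assumes "u \<in> product_sums"
  shows "continuous_on UNIV u \<and> partial_deriv i u \<in> product_sums \<and>
    (\<forall>x. ((\<lambda>t. u (x + t *\<^sub>R axis i 1)) has_vector_derivative partial_deriv i u x) (at 0))"
  using assms
proof induction
  case (prod f g)
  have *: "((\<lambda>t. f (x + t *\<^sub>R axis i 1) * g (x + t *\<^sub>R axis i 1)) has_vector_derivative
     (f x * partial_deriv i g x + partial_deriv i f x * g x)) (at 0)" for x
    using has_vector_derivative_mult[OF prod[THEN smooth_has_partial_deriv_0, of x i]] by simp
  then have "partial_deriv i (\<lambda>x. f x * g x) = (\<lambda>x. f x * partial_deriv i g x + partial_deriv i f x * g x)"
    by (intro ext partial_derivI)
  then show ?case
    using * prod continuous_on_mult[OF prod[THEN smooth_continuous]]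
    by (auto intro!: product_sums.add product_sums.prod smooth_partial_deriv)
next
  case (add u v)
  then have *: "((\<lambda>t. u (x + t *\<^sub>R axis i 1) + v (x + t *\<^sub>R axis i 1)) has_vector_derivative
     (partial_deriv i u x + partial_deriv i v x)) (at 0)" for x
    by (intro has_vector_derivative_add) auto
  then have "partial_deriv i (\<lambda>x. u x + v x) = (\<lambda>x. partial_deriv i u x + partial_deriv i v x)"
    by (intro ext partial_derivI)
  then show ?case
    using * add by (auto intro!: product_sums.intros continuous_intros)
qed

lemma smooth_mult:
  assumes "smooth f" "smooth g"
  shows "smooth (\<lambda>x. f x * g x)"
proof (rule smoothI[of _ product_sums])
  show "(\<lambda>x. f x * g x) \<in> product_sums"
    using assms by (rule product_sums.prod)
qed (use product_sums_partial_deriv differentiableI_vector in blast)+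

lemma smooth_const: "smooth (\<lambda>x. c)"
proof (rule smoothI[of _ "range (\<lambda>c x. c)"])
  fix g :: "real^'n \<Rightarrow> complex" and i :: 'n
  assume "g \<in> range (\<lambda>c x. c)"
  then obtain c where "g = (\<lambda>x. c)" by auto
  moreover have "partial_deriv i (\<lambda>x. c) = (\<lambda>x. 0)"
    by (intro ext partial_derivI) simp
  ultimately show "partial_deriv i g \<in> range (\<lambda>c x. c)" by auto
qed auto

lemma smooth_prod: "finite I \<Longrightarrow> (\<And>i. i \<in> I \<Longrightarrow> smooth (f i)) \<Longrightarrow> smooth (\<lambda>x. \<Prod>i\<in>I. f i x)"
  by (induction I rule: finite_induct) (auto intro: smooth_const smooth_mult)


section \<open>Bump functions\<close>

text \<open>The classical flat function exp(-1/x), extended by 0. The polynomial factor in 1/x makes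
  the family closed under differentiation.\<close>

definition flat_exp :: "real poly \<Rightarrow> real \<Rightarrow> real"
  where "flat_exp P x = (if x > 0 then poly P (1 / x) * exp (- (1 / x)) else 0)"

lemma poly_exp_tendsto_0: "((\<lambda>x::real. poly P x * exp (- x)) \<longlongrightarrow> 0) at_top"
proof -
  have "((\<lambda>x::real. coeff P i * (x ^ i / exp x)) \<longlongrightarrow> coeff P i * 0) at_top" for i
    by (intro tendsto_intros tendsto_power_div_exp_0)
  then have "((\<lambda>x::real. \<Sum>i\<le>degree P. coeff P i * (x ^ i / exp x)) \<longlongrightarrow> (\<Sum>i\<le>degree P. coeff P i * 0)) at_top"
    by (intro tendsto_sum)
  then show ?thesis
    by (simp add: poly_altdef sum_distrib_right exp_minus divide_inverse mult.assoc)
qed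

lemma flat_exp_tendsto_0: "(flat_exp P \<longlongrightarrow> 0) (at 0)"
proof -
  have "(flat_exp P \<longlongrightarrow> 0) (at_left 0)"
    by (rule tendsto_eventually) (auto simp: eventually_at_filter flat_exp_def)
  moreover have "((\<lambda>x. poly P (inverse x) * exp (- inverse x)) \<longlongrightarrow> 0) (at_right (0::real))"
    using filterlim_compose[OF poly_exp_tendsto_0 filterlim_inverse_at_top_right] .
  then have "(flat_exp P \<longlongrightarrow> 0) (at_right 0)"
    by (rule Lim_transform_eventually) (auto simp: eventually_at_filter flat_exp_def inverse_eq_divide)
  ultimately show ?thesis
    by (simp add: filterlim_at_split)
qed

text \<open>With u = 1/x one has d/dx = -u^2 d/du, and d/du sends P exp(-u) to (P' - P) exp(-u);
  hence the new polynomial u^2 (P - P').\<close>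

definition flat_exp_deriv :: "real poly \<Rightarrow> real poly"
  where "flat_exp_deriv P = monom 1 2 * (P - pderiv P)"

lemma flat_exp_has_derivative:
  "(flat_exp P has_real_derivative flat_exp (flat_exp_deriv P) x) (at x)"
proof -
  consider "x > 0" | "x < 0" | "x = 0" by linarith
  then show ?thesis
  proof cases
    case 1
    have "((\<lambda>x. poly P (1 / x) * exp (- (1 / x))) has_real_derivative flat_exp (flat_exp_deriv P) x) (at x)"
      using 1 by (auto intro!: derivative_eq_intros poly_DERIV[THEN DERIV_chain2]
          simp: flat_exp_def flat_exp_deriv_def poly_monom field_simps power2_eq_square)
    then show ?thesis
      by (rule has_field_derivative_transform_within_open[where S="{0<..}"]) (auto simp: 1 flat_exp_def)
  next
    case 2
    have "((\<lambda>x. 0) has_real_derivative flat_exp (flat_exp_deriv P) x) (at x)"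
      using 2 by (simp add: flat_exp_def)
    then show ?thesis
      by (rule has_field_derivative_transform_within_open[where S="{..<0}"]) (auto simp: 2 flat_exp_def)
  next
    case 3
    \<comment> \<open>The difference quotient at 0 stays in the family: division by y multiplies the
      polynomial in 1/y by its variable, whence \<open>monom 1 1 * P\<close>.\<close>
    have "((\<lambda>y. (flat_exp P y - flat_exp P 0) / (y - 0)) \<longlongrightarrow> 0) (at 0)"
      by (rule Lim_transform_eventually[OF flat_exp_tendsto_0[of "monom 1 1 * P"]])
        (auto simp: eventually_at_filter flat_exp_def poly_monom field_simps)
    then show ?thesis
      using 3 by (simp add: has_field_derivative_iff flat_exp_def)
  qed
qed

lemma smooth_flat_exp_coordinate:
  fixes i :: "'n::finite"
  shows "smooth (\<lambda>x::real^'n. complex_of_real (flat_exp P (c * x $ i + d)))"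
proof -
  \<comment> \<open>The scalar K absorbs the chain rule factor c of each derivative along i; a
    derivative along another coordinate gives K = 0.\<close>
  define S where "S = {(\<lambda>x::real^'n. complex_of_real (K * flat_exp P (c * x $ i + d))) | K P. True}"
  have *: "((\<lambda>t. complex_of_real (K * flat_exp P (c * (x + t *\<^sub>R axis j 1) $ i + d))) has_vector_derivative
     complex_of_real ((if j = i then K * c else 0) * flat_exp (flat_exp_deriv P) (c * x $ i + d))) (at 0)"
    for K P j x
    apply (rule has_vector_derivative_of_real)
    apply (auto simp: has_real_derivative_iff_has_vector_derivative[symmetric] axis_def
      intro!: derivative_eq_intros flat_exp_has_derivative[THEN DERIV_chain2])
    done
  have cont: "continuous_on UNIV (flat_exp P)" for P
    using flat_exp_has_derivative by (meson DERIV_continuous continuous_at_imp_continuous_on)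
  have "smooth (\<lambda>x::real^'n. complex_of_real (1 * flat_exp P (c * x $ i + d)))"
  proof (rule smoothI[of _ S])
    fix g j x
    assume "g \<in> S"
    then obtain K P where g: "g = (\<lambda>x::real^'n. complex_of_real (K * flat_exp P (c * x $ i + d)))"
      by (auto simp: S_def)
    have "partial_deriv j g =
        (\<lambda>x. complex_of_real ((if j = i then K * c else 0) * flat_exp (flat_exp_deriv P) (c * x $ i + d)))"
      unfolding g by (intro ext partial_derivI *)
    then show "partial_deriv j g \<in> S"
      unfolding S_def by blast
    show "(\<lambda>t::real. g (x + t *\<^sub>R axis j 1)) differentiable (at 0)"
      unfolding g using * differentiableI_vector by blast
    show "continuous_on UNIV g"
      unfolding g by (intro continuous_intros continuous_on_compose2[OF cont]) auto
  qed (unfold S_def, blast)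
  then show ?thesis by simp
qed

text \<open>
  Since \<open>exp (-1/(n s))\<close> tends to \<open>1\<close> for every \<open>s > 0\<close>, these functions converge pointwise to
  the indicator of the open box, from below.
\<close>

definition box_bump :: "real^'n::finite \<Rightarrow> real^'n \<Rightarrow> nat \<Rightarrow> real^'n \<Rightarrow> real"
  where "box_bump a b n x =
    (\<Prod>i\<in>UNIV. flat_exp 1 (real n * x $ i + - (real n * a $ i)) * flat_exp 1 (- real n * x $ i + real n * b $ i))"

lemma smooth_box_bump: "smooth (\<lambda>x. complex_of_real (box_bump a b n x))"
  unfolding box_bump_def of_real_prod of_real_mult
  by (intro smooth_prod smooth_mult smooth_flat_exp_coordinate) auto

lemma flat_exp_1_bounds: "0 \<le> flat_exp 1 x" "flat_exp 1 x \<le> 1"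
  by (auto simp: flat_exp_def)

lemma box_bump_bounds:
  "0 \<le> box_bump a b n x" "box_bump a b n x \<le> 1" "x \<notin> box a b \<Longrightarrow> box_bump a b n x = 0"
proof -
  show "0 \<le> box_bump a b n x" "box_bump a b n x \<le> 1"
    unfolding box_bump_def by (auto intro!: prod_nonneg prod_le_1 mult_le_one simp: flat_exp_1_bounds)
  assume "x \<notin> box a b"
  then obtain i where "\<not> (a $ i < x $ i \<and> x $ i < b $ i)"
    by (auto simp: mem_box_cart)
  then have "\<not> real n * x $ i + - (real n * a $ i) > 0 \<or> \<not> - real n * x $ i + real n * b $ i > 0"
    by (auto simp: not_less mult_left_mono)
  then show "box_bump a b n x = 0"
    unfolding box_bump_def by (intro prod_zero) (auto simp: flat_exp_def intro!: bexI[of _ i])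
qed

lemma flat_exp_1_tendsto_1:
  assumes "s > 0"
  shows "(\<lambda>n. flat_exp 1 (real n * s)) \<longlonglongrightarrow> 1"
proof -
  have "(\<lambda>n. exp (- ((1 / s) / real n))) \<longlonglongrightarrow> exp (- 0)"
    by (intro tendsto_intros tendsto_divide_0[OF tendsto_const] filterlim_at_top_imp_at_infinity filterlim_real_sequentially)
  then have "(\<lambda>n. exp (- ((1 / s) / real n))) \<longlonglongrightarrow> 1" by simp
  then show ?thesis
    by (rule Lim_transform_eventually)
      (use assms in \<open>auto intro!: eventually_mono[OF eventually_gt_at_top[of 0]] simp: flat_exp_def field_simps\<close>)
qed

lemma box_bump_tendsto: "(\<lambda>n. box_bump a b n x) \<longlonglongrightarrow> indicator (box a b) x"
proof (cases "x \<in> box a b")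
  case True
  have "(\<lambda>n. box_bump a b n x) \<longlonglongrightarrow> (\<Prod>i\<in>(UNIV::'a set). 1 * 1)"
    unfolding box_bump_def
  proof (intro tendsto_prod tendsto_mult)
    fix i
    show "(\<lambda>n. flat_exp 1 (real n * x $ i + - (real n * a $ i))) \<longlonglongrightarrow> 1"
      "(\<lambda>n. flat_exp 1 (- real n * x $ i + real n * b $ i)) \<longlonglongrightarrow> 1"
      using flat_exp_1_tendsto_1[of "x $ i - a $ i"] flat_exp_1_tendsto_1[of "b $ i - x $ i"] True
      by (auto simp: mem_box_cart algebra_simps)
  qed
  then show ?thesis using True by simp
qed (simp add: box_bump_bounds)

lemma test_functionI:
  assumes "smooth \<psi>" "\<And>x. norm x > R \<Longrightarrow> \<psi> x = 0"
  shows "test_function \<psi>"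
proof -
  have "support_on UNIV \<psi> \<subseteq> cball 0 R"
    using assms(2) by (force simp: support_on_def)
  then have "closure (support_on UNIV \<psi>) \<subseteq> cball 0 R"
    by (intro closure_minimal) auto
  then show ?thesis
    unfolding test_function_def
    by (meson assms(1) bounded_cball bounded_subset closed_closure compact_eq_bounded_closed)
qed

lemma test_function_support:
  assumes "test_function \<psi>"
  obtains R where "\<And>x. norm x > R \<Longrightarrow> \<psi> x = 0"
proof -
  have "bounded (support_on UNIV \<psi>)"
    using assms unfolding test_function_def by (meson bounded_subset closure_subset compact_imp_bounded)
  then obtain R where "\<And>x. x \<in> support_on UNIV \<psi> \<Longrightarrow> norm x \<le> R"
    by (auto simp: bounded_iff)
  then show ?thesis
    by (intro that[of R]) (force simp: support_on_def)
qed

lemma test_function_box_bump: "test_function (\<lambda>x. complex_of_real (box_bump a b n x))"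
proof -
  obtain R where R: "\<And>x. x \<in> box a b \<Longrightarrow> norm x \<le> R"
    using bounded_box[of a b] by (auto simp: bounded_iff)
  show ?thesis
    by (rule test_functionI[OF smooth_box_bump, of R]) (use R box_bump_bounds(3) in force)
qed


section \<open>Step differences and step averages\<close>

definition step_diff :: "real \<Rightarrow> 'n::finite \<Rightarrow> (real^'n \<Rightarrow> complex) \<Rightarrow> real^'n \<Rightarrow> complex"
  where "step_diff h t f x = f x - f (x - h *\<^sub>R axis t 1)"

text \<open>The parameter runs over [0,1] instead of a segment of length |h|, so the sign of h is
  immaterial. Negative steps do occur: passing to the adjoint turns h into -h, and \<alpha> itself
  may be negative.\<close>

definition step_avg :: "real \<Rightarrow> 'n::finite \<Rightarrow> (real^'n \<Rightarrow> complex) \<Rightarrow> real^'n \<Rightarrow> complex"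
  where "step_avg h t f x = (LINT s|lborel. indicator {0..1} s *\<^sub>R f (x - (s * h) *\<^sub>R axis t 1))"

lemma step_avg_eq_integral:
  assumes "continuous_on UNIV f"
  shows "step_avg h t f x = integral {0..1} (\<lambda>s. f (x - (s * h) *\<^sub>R axis t 1))"
proof -
  have "continuous_on {0..1} (\<lambda>s. f (x - (s * h) *\<^sub>R axis t 1))"
    by (intro continuous_on_compose2[OF assms] continuous_intros) auto
  then have "set_integrable lborel {0..1} (\<lambda>s. f (x - (s * h) *\<^sub>R axis t 1))"
    unfolding set_integrable_def by (intro borel_integrable_compact) auto
  then show ?thesis
    using set_borel_integral_eq_integral(2) unfolding step_avg_def set_lebesgue_integral_def by blast
qed

text \<open>Differentiation under an integral over a compact interval; joint continuity of the
  differentiated integrand justifies it.\<close>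

lemma step_avg_has_partial_deriv:
  assumes "smooth \<psi>"
  shows "((\<lambda>r. step_avg h t \<psi> (x + r *\<^sub>R axis i 1)) has_vector_derivative
    step_avg h t (partial_deriv i \<psi>) x) (at 0)"
proof -
  have 1: "((\<lambda>r. \<psi> (x + r *\<^sub>R axis i 1 - (s * h) *\<^sub>R axis t 1)) has_vector_derivative
      partial_deriv i \<psi> (x + r *\<^sub>R axis i 1 - (s * h) *\<^sub>R axis t 1)) (at r)" for r s
    using smooth_has_partial_deriv[OF assms, of "x - (s * h) *\<^sub>R axis t 1" i r]
    by (simp add: algebra_simps)
  have "((\<lambda>r. integral (cbox 0 1) (\<lambda>s. \<psi> (x + r *\<^sub>R axis i 1 - (s * h) *\<^sub>R axis t 1)))
    has_vector_derivative integral (cbox 0 1) (\<lambda>s. partial_deriv i \<psi> (x + 0 *\<^sub>R axis i 1 - (s * h) *\<^sub>R axis t 1)))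
    (at 0 within UNIV)"
  proof (rule leibniz_rule_vector_derivative)
    show "(\<lambda>s. \<psi> (x + r *\<^sub>R axis i 1 - (s * h) *\<^sub>R axis t 1)) integrable_on cbox 0 1" for r
      by (intro integrable_continuous continuous_on_compose2[OF smooth_continuous[OF assms]] continuous_intros) auto
    show "continuous_on (UNIV \<times> cbox 0 1)
        (\<lambda>(r, s). partial_deriv i \<psi> (x + r *\<^sub>R axis i 1 - (s * h) *\<^sub>R axis t 1))"
      unfolding split_beta
      by (intro continuous_on_compose2[OF smooth_continuous[OF smooth_partial_deriv[OF assms]]] continuous_intros) auto
  qed (use 1 in auto)
  then show ?thesis
    using assms by (simp add: step_avg_eq_integral smooth_continuous smooth_partial_deriv)
qed

lemma partial_deriv_step_avg:
  "smooth \<psi> \<Longrightarrow> partial_deriv i (step_avg h t \<psi>) = step_avg h t (partial_deriv i \<psi>)"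
  by (intro ext partial_derivI step_avg_has_partial_deriv)

lemma continuous_on_step_avg:
  assumes "continuous_on UNIV f"
  shows "continuous_on UNIV (step_avg h t f)"
proof -
  have "continuous_on UNIV (\<lambda>x. integral (cbox 0 1) (\<lambda>s. f (x - (s * h) *\<^sub>R axis t 1)))"
    by (rule integral_continuous_on_param)
      (unfold split_beta, intro continuous_on_compose2[OF assms] continuous_intros, auto)
  then show ?thesis
    using assms by (simp add: step_avg_eq_integral)
qed

lemma smooth_step_avg:
  assumes "smooth \<psi>"
  shows "smooth (step_avg h t \<psi>)"
proof (rule smoothI[of _ "step_avg h t ` Collect smooth"])
  fix g i x
  assume "g \<in> step_avg h t ` Collect smooth"
  then obtain \<psi> where \<psi>: "smooth \<psi>" "g = step_avg h t \<psi>" by auto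
  show "(\<lambda>t::real. g (x + t *\<^sub>R axis i 1)) differentiable (at 0)"
    unfolding \<psi>(2) by (rule differentiableI_vector[OF step_avg_has_partial_deriv[OF \<psi>(1)]])
  show "continuous_on UNIV g" "partial_deriv i g \<in> step_avg h t ` Collect smooth"
    using \<psi> by (auto simp: partial_deriv_step_avg smooth_partial_deriv continuous_on_step_avg smooth_continuous)
qed (use assms in auto)

lemma smooth_foldr_step_avg: "smooth \<psi> \<Longrightarrow> smooth (foldr (step_avg h) L \<psi>)"
  by (induction L) (auto intro: smooth_step_avg)

lemma partial_deriv_foldr_step_avg:
  assumes "smooth \<psi>"
  shows "partial_deriv i (foldr (step_avg h) L \<psi>) = foldr (step_avg h) L (partial_deriv i \<psi>)"
  using assms
  by (induction L) (auto simp: partial_deriv_step_avg smooth_foldr_step_avg)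

lemma step_diff_eq_step_avg:
  assumes "smooth \<psi>"
  shows "step_diff h t \<psi> x = complex_of_real h * step_avg h t (partial_deriv t \<psi>) x"
proof -
  have "((\<lambda>s. \<psi> (x - (s * h) *\<^sub>R axis t 1)) has_vector_derivative
      (- h) *\<^sub>R partial_deriv t \<psi> (x - (s * h) *\<^sub>R axis t 1)) (at s)" for s
  proof -
    have "((\<lambda>t'. \<psi> (x + t' *\<^sub>R axis t 1)) \<circ> (\<lambda>s. s * - h) has_vector_derivative
        (- h) *\<^sub>R partial_deriv t \<psi> (x + (s * - h) *\<^sub>R axis t 1)) (at s)"
      by (rule vector_diff_chain_at[OF _ smooth_has_partial_deriv[OF assms]]) (auto intro!: derivative_eq_intros)
    then show ?thesis by (simp add: o_def)
  qed
  then have "((\<lambda>s. (- h) *\<^sub>R partial_deriv t \<psi> (x - (s * h) *\<^sub>R axis t 1)) has_integral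
      (\<psi> (x - (1 * h) *\<^sub>R axis t 1) - \<psi> (x - (0 * h) *\<^sub>R axis t 1))) {0..1}"
    by (intro fundamental_theorem_of_calculus) (auto intro: has_vector_derivative_at_within)
  from integral_unique[OF this] show ?thesis
    using assms
    by (simp add: step_avg_eq_integral smooth_continuous smooth_partial_deriv step_diff_def scaleR_conv_of_real
        algebra_simps)
qed

lemma step_diff_cmult: "step_diff h t (\<lambda>x. c * f x) = (\<lambda>x. c * step_diff h t f x)"
  unfolding step_diff_def fun_eq_iff by (simp add: algebra_simps)

text \<open>The induction produces the averages outside; they commute with partial derivatives and
  are then moved inside. In this form the derivatives act on a test function, exactly as in the
  definition of a weak derivative.\<close>

lemma foldr_step_diff_eq_step_avg:
  assumes "smooth \<psi>"
  shows "foldr (step_diff h) L \<psi> =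
    (\<lambda>x. complex_of_real h ^ length L * foldr partial_deriv L (foldr (step_avg h) L \<psi>) x)"
proof -
  have comm: "foldr partial_deriv L' (foldr (step_avg h) L \<psi>) = foldr (step_avg h) L (foldr partial_deriv L' \<psi>)"
    for L L'
    by (induction L') (auto simp: partial_deriv_foldr_step_avg smooth_foldr_partial_deriv assms)
  have "foldr (step_diff h) L \<psi> =
      (\<lambda>x. complex_of_real h ^ length L * foldr (step_avg h) L (foldr partial_deriv L \<psi>) x)"
  proof (induction L)
    case (Cons t L)
    have *: "smooth (foldr (step_avg h) L (foldr partial_deriv L \<psi>))"
      by (intro smooth_foldr_step_avg smooth_foldr_partial_deriv assms)
    have "foldr (step_diff h) (t # L) \<psi> =
      step_diff h t (\<lambda>x. complex_of_real h ^ length L * foldr (step_avg h) L (foldr partial_deriv L \<psi>) x)"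
      by (simp add: Cons.IH)
    also have "\<dots> = (\<lambda>x. complex_of_real h ^ length L *
       (complex_of_real h * step_avg h t (partial_deriv t (foldr (step_avg h) L (foldr partial_deriv L \<psi>))) x))"
      unfolding step_diff_cmult using * by (simp add: step_diff_eq_step_avg)
    also have "partial_deriv t (foldr (step_avg h) L (foldr partial_deriv L \<psi>)) =
       foldr (step_avg h) L (foldr partial_deriv (t # L) \<psi>)"
      by (simp add: partial_deriv_foldr_step_avg smooth_foldr_partial_deriv assms)
    finally show ?case
      by (simp add: mult.assoc mult.left_commute)
  qed simp
  then show ?thesis
    by (simp only: comm)
qed

lemma step_avg_support:
  assumes "\<And>x. norm x > R \<Longrightarrow> f x = 0" "norm x > R + \<bar>h\<bar>"
  shows "step_avg h t f x = 0"
proof -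
  have "f (x - (s * h) *\<^sub>R axis t 1) = 0" if "s \<in> {0..1}" for s
  proof (rule assms(1))
    have "norm ((s * h) *\<^sub>R axis t (1::real)) \<le> \<bar>h\<bar>"
      using that by (simp add: abs_mult mult_left_le_one_le)
    then show "norm (x - (s * h) *\<^sub>R axis t 1) > R"
      using assms(2) norm_triangle_ineq2[of x "(s * h) *\<^sub>R axis t (1::real)"] by linarith
  qed
  then have "(\<lambda>s. indicator {0..1} s *\<^sub>R f (x - (s * h) *\<^sub>R axis t 1)) = (\<lambda>s. 0)"
    by (intro ext) (simp add: indicator_def)
  then show ?thesis
    unfolding step_avg_def by simp
qed

lemma test_function_step_avg:
  assumes "test_function \<psi>"
  shows "test_function (step_avg h t \<psi>)"
proof -
  obtain R where "\<And>x. norm x > R \<Longrightarrow> \<psi> x = 0"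
    using test_function_support[OF assms] by blast
  then show ?thesis
    using assms by (intro test_functionI[of _ "R + \<bar>h\<bar>"] smooth_step_avg step_avg_support)
      (auto simp: test_function_def)
qed

lemma test_function_foldr_step_avg: "test_function \<psi> \<Longrightarrow> test_function (foldr (step_avg h) L \<psi>)"
  by (induction L) (auto intro: test_function_step_avg)

lemma test_function_step_diff:
  assumes "test_function \<psi>"
  shows "test_function (step_diff h t \<psi>)"
proof -
  have \<psi>: "smooth \<psi>" using assms by (simp add: test_function_def)
  obtain R where R: "\<And>x. norm x > R \<Longrightarrow> \<psi> x = 0"
    using test_function_support[OF assms] by blast
  \<comment> \<open>Smoothness is inherited from the average of the partial derivative, while the
    support is read off from the difference itself.\<close>
  have "step_diff h t \<psi> = (\<lambda>x. complex_of_real h * step_avg h t (partial_deriv t \<psi>) x)"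
    using step_diff_eq_step_avg[OF \<psi>] by blast
  moreover have "smooth \<dots>"
    by (intro smooth_mult smooth_const smooth_step_avg smooth_partial_deriv \<psi>)
  moreover have "step_diff h t \<psi> x = 0" if "norm x > R + \<bar>h\<bar>" for x
    using that norm_triangle_ineq2[of x "h *\<^sub>R axis t (1::real)"]
    using R[of x] R[of "x - h *\<^sub>R axis t 1"] by (simp add: step_diff_def)
  ultimately show ?thesis
    by (intro test_functionI[of _ "R + \<bar>h\<bar>"]) auto
qed

lemma test_function_foldr_step_diff: "test_function \<psi> \<Longrightarrow> test_function (foldr (step_diff h) L \<psi>)"
  by (induction L) (auto intro: test_function_step_diff)

lemma test_function_bounded:
  assumes "test_function \<psi>"
  obtains B where "\<And>x. norm (\<psi> x) \<le> B"
proof -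
  obtain R where R: "\<And>x. norm x > R \<Longrightarrow> \<psi> x = 0"
    using test_function_support[OF assms] by blast
  have "continuous_on (cball 0 R) \<psi>"
    using assms by (meson continuous_on_subset smooth_continuous subset_UNIV test_function_def)
  then have "bounded (\<psi> ` cball 0 R)"
    by (intro compact_imp_bounded compact_continuous_image) auto
  then obtain B where B: "\<And>x. norm x \<le> R \<Longrightarrow> norm (\<psi> x) \<le> B"
    by (force simp: bounded_iff)
  have "norm (\<psi> x) \<le> max B 0" for x
    using R[of x] B[of x] by (cases "norm x \<le> R") (auto simp: le_max_iff_disj)
  then show ?thesis by (rule that)
qed


section \<open>Pairing with test functions\<close>

lemma borel_measurable_test_function: "test_function \<psi> \<Longrightarrow> \<psi> \<in> borel_measurable borel"
  by (intro borel_measurable_continuous_onI smooth_continuous) (simp add: test_function_def)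

lemma nn_integral_lborel_translate:
  fixes f :: "'a::euclidean_space \<Rightarrow> ennreal"
  assumes [measurable]: "f \<in> borel_measurable borel"
  shows "(\<integral>\<^sup>+x. f (x + v) \<partial>lborel) = (\<integral>\<^sup>+x. f x \<partial>lborel)"
proof -
  have "(\<integral>\<^sup>+x. f x \<partial>lborel) = (\<integral>\<^sup>+x. f x \<partial>distr lborel borel ((+) v))"
    by (simp add: lborel_distr_plus)
  also have "\<dots> = (\<integral>\<^sup>+x. f (x + v) \<partial>lborel)"
    by (subst nn_integral_distr) (auto simp: add.commute)
  finally show ?thesis ..
qed

lemma integral_lborel_translate:
  fixes f :: "'a::euclidean_space \<Rightarrow> 'b::{banach,second_countable_topology}"
  assumes [measurable]: "f \<in> borel_measurable borel"
  shows "(LINT x|lborel. f (x + v)) = (LINT x|lborel. f x)"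
    and "integrable lborel (\<lambda>x. f (x + v)) \<longleftrightarrow> integrable lborel f"
proof -
  have "(LINT x|lborel. f x) = (LINT x|distr lborel borel ((+) v). f x)"
    "integrable lborel f \<longleftrightarrow> integrable (distr lborel borel ((+) v)) f"
    by (simp_all add: lborel_distr_plus)
  then show "(LINT x|lborel. f (x + v)) = (LINT x|lborel. f x)"
    "integrable lborel (\<lambda>x. f (x + v)) \<longleftrightarrow> integrable lborel f"
    by (auto simp: integral_distr integrable_distr_eq add.commute)
qed

text \<open>Where f is not integrable the left side is 0 by the default value of the integral. This
  covers the points at which the average of a merely locally integrable function does not
  exist.\<close>

lemma norm_integral_le_nn_integral:
  fixes f :: "'a \<Rightarrow> 'b::{banach,second_countable_topology}"
  shows "ennreal (norm (LINT x|M. f x)) \<le> (\<integral>\<^sup>+x. ennreal (norm (f x)) \<partial>M)"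
  by (cases "integrable M f") (auto simp: integral_norm_bound_ennreal not_integrable_integral_eq)

text \<open>The Borel counterpart of \<open>locally_integrable\<close>. Borel measurability makes
  (x, s) -> f (x - s h e_t) measurable on the product, and balls are easy to enlarge when f is
  translated.\<close>

definition locally_L1 :: "(real^'n::finite \<Rightarrow> complex) \<Rightarrow> bool"
  where "locally_L1 f \<longleftrightarrow> f \<in> borel_measurable borel \<and>
    (\<forall>R. (\<integral>\<^sup>+x. ennreal (norm (f x)) * indicator (cball 0 R) x \<partial>lborel) < \<infinity>)"

lemma pred_cball [measurable (raw)]:
  fixes f :: "'a \<Rightarrow> 'b::euclidean_space"
  assumes [measurable]: "f \<in> borel_measurable M"
  shows "Measurable.pred M (\<lambda>x. f x \<in> cball c R)"
  unfolding mem_cball by measurable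

lemma nn_integral_cball_translate:
  fixes f :: "real^'n::finite \<Rightarrow> complex"
  assumes [measurable]: "f \<in> borel_measurable borel" and "norm v \<le> K"
  shows "(\<integral>\<^sup>+x. ennreal (norm (f (x - v))) * indicator (cball 0 R) x \<partial>lborel) \<le>
    (\<integral>\<^sup>+x. ennreal (norm (f x)) * indicator (cball 0 (R + K)) x \<partial>lborel)"
proof -
  have "(\<integral>\<^sup>+x. ennreal (norm (f (x - v))) * indicator (cball 0 R) x \<partial>lborel) =
      (\<integral>\<^sup>+x. ennreal (norm (f (x + v - v))) * indicator (cball 0 R) (x + v) \<partial>lborel)"
    by (rule nn_integral_lborel_translate[symmetric]) measurable
  also have "\<dots> \<le> (\<integral>\<^sup>+x. ennreal (norm (f x)) * indicator (cball 0 (R + K)) x \<partial>lborel)"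
  proof (intro nn_integral_mono)
    fix x :: "real^'n"
    have "norm x \<le> R + K" if "norm (x + v) \<le> R"
      using that assms(2) norm_diff_ineq[of x v] by linarith
    then show "ennreal (norm (f (x + v - v))) * indicator (cball 0 R) (x + v) \<le>
        ennreal (norm (f x)) * indicator (cball 0 (R + K)) x"
      by (auto simp: indicator_def)
  qed
  finally show ?thesis .
qed

lemma borel_measurable_step_diff [measurable]:
  assumes [measurable]: "f \<in> borel_measurable borel"
  shows "step_diff h t f \<in> borel_measurable borel"
  unfolding step_diff_def[abs_def] by measurable

lemma borel_measurable_step_avg [measurable]:
  assumes [measurable]: "f \<in> borel_measurable borel"
  shows "step_avg h t f \<in> borel_measurable borel"
proof -
  have "(\<lambda>x. LINT s|lborel. indicator {0..1} s *\<^sub>R f (x - (s * h) *\<^sub>R axis t 1)) \<in> borel_measurable borel"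
    by (rule lborel.borel_measurable_lebesgue_integral) (unfold split_beta, measurable)
  then show ?thesis
    by (simp add: step_avg_def[abs_def])
qed

lemma locally_L1_step_diff:
  assumes "locally_L1 f"
  shows "locally_L1 (step_diff h t f)"
proof -
  have f[measurable]: "f \<in> borel_measurable borel" using assms by (simp add: locally_L1_def)
  have "(\<integral>\<^sup>+x. ennreal (norm (step_diff h t f x)) * indicator (cball 0 R) x \<partial>lborel) < \<infinity>" for R
  proof -
    have "(\<integral>\<^sup>+x. ennreal (norm (step_diff h t f x)) * indicator (cball 0 R) x \<partial>lborel) \<le>
       (\<integral>\<^sup>+x. ennreal (norm (f x)) * indicator (cball 0 R) x +
          ennreal (norm (f (x - h *\<^sub>R axis t 1))) * indicator (cball 0 R) x \<partial>lborel)"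
      by (intro nn_integral_mono)
        (auto simp: step_diff_def indicator_def ennreal_plus[symmetric] norm_triangle_ineq4 simp del: ennreal_plus
          intro!: ennreal_leI)
    also have "\<dots> = (\<integral>\<^sup>+x. ennreal (norm (f x)) * indicator (cball 0 R) x \<partial>lborel) +
       (\<integral>\<^sup>+x. ennreal (norm (f (x - h *\<^sub>R axis t 1))) * indicator (cball 0 R) x \<partial>lborel)"
      by (intro nn_integral_add) measurable
    also have "\<dots> \<le> (\<integral>\<^sup>+x. ennreal (norm (f x)) * indicator (cball 0 R) x \<partial>lborel) +
       (\<integral>\<^sup>+x. ennreal (norm (f x)) * indicator (cball 0 (R + \<bar>h\<bar>)) x \<partial>lborel)"
      by (intro add_left_mono nn_integral_cball_translate) auto
    also have "\<dots> < \<infinity>"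
      using assms by (auto simp: locally_L1_def)
    finally show ?thesis .
  qed
  then show ?thesis by (simp add: locally_L1_def)
qed

text \<open>Tonelli puts the integral over the ball inside the average. All translates have length
  at most |h|, so one larger ball bounds them uniformly in s.\<close>

lemma locally_L1_step_avg:
  assumes "locally_L1 f"
  shows "locally_L1 (step_avg h t f)"
proof -
  have f[measurable]: "f \<in> borel_measurable borel" using assms by (simp add: locally_L1_def)
  have "(\<integral>\<^sup>+x. ennreal (norm (step_avg h t f x)) * indicator (cball 0 R) x \<partial>lborel) < \<infinity>" for R
  proof -
    let ?C = "\<integral>\<^sup>+x. ennreal (norm (f x)) * indicator (cball 0 (R + \<bar>h\<bar>)) x \<partial>lborel"
    have "(\<integral>\<^sup>+x. ennreal (norm (step_avg h t f x)) * indicator (cball 0 R) x \<partial>lborel) \<le>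
       (\<integral>\<^sup>+x. (\<integral>\<^sup>+s. indicator {0..1::real} s * (ennreal (norm (f (x - (s * h) *\<^sub>R axis t 1))) *
         indicator (cball 0 R) x) \<partial>lborel) \<partial>lborel)"
    proof (intro nn_integral_mono)
      fix x :: "real^'a"
      have "ennreal (norm (step_avg h t f x)) \<le>
          (\<integral>\<^sup>+s. ennreal (norm (indicator {0..1::real} s *\<^sub>R f (x - (s * h) *\<^sub>R axis t 1))) \<partial>lborel)"
        unfolding step_avg_def by (rule norm_integral_le_nn_integral)
      also have "\<dots> = (\<integral>\<^sup>+s. indicator {0..1::real} s * ennreal (norm (f (x - (s * h) *\<^sub>R axis t 1))) \<partial>lborel)"
        by (intro nn_integral_cong) (auto simp: indicator_def)
      finally show "ennreal (norm (step_avg h t f x)) * indicator (cball 0 R) x \<le>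
          (\<integral>\<^sup>+s. indicator {0..1::real} s * (ennreal (norm (f (x - (s * h) *\<^sub>R axis t 1))) *
            indicator (cball 0 R) x) \<partial>lborel)"
        by (auto simp: indicator_def)
    qed
    also have "\<dots> = (\<integral>\<^sup>+s. (\<integral>\<^sup>+x. indicator {0..1::real} s * (ennreal (norm (f (x - (s * h) *\<^sub>R axis t 1))) *
         indicator (cball 0 R) x) \<partial>lborel) \<partial>lborel)"
      by (rule lborel_pair.Fubini'[symmetric]) (unfold split_beta, measurable)
    also have "\<dots> \<le> (\<integral>\<^sup>+s. indicator {0..1::real} s * ?C \<partial>lborel)"
    proof (intro nn_integral_mono)
      fix s :: real
      have "(\<integral>\<^sup>+x. (ennreal (norm (f (x - (s * h) *\<^sub>R axis t 1))) * indicator (cball 0 R) x) \<partial>lborel) \<le> ?C"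
        if "s \<in> {0..1}"
        using that by (intro nn_integral_cball_translate) (auto simp: abs_mult mult_left_le_one_le)
      then show "(\<integral>\<^sup>+x. indicator {0..1::real} s * (ennreal (norm (f (x - (s * h) *\<^sub>R axis t 1))) *
         indicator (cball 0 R) x) \<partial>lborel) \<le> indicator {0..1::real} s * ?C"
        by (auto simp: indicator_def)
    qed
    also have "\<dots> = ?C"
      by (subst nn_integral_multc) auto
    also have "\<dots> < \<infinity>"
      using assms by (auto simp: locally_L1_def)
    finally show ?thesis .
  qed
  then show ?thesis by (simp add: locally_L1_def)
qed

lemma locally_L1_fold:
  assumes "locally_L1 f"
  shows "locally_L1 (fold (step_diff h) L f)" "locally_L1 (fold (step_avg h) L f)"
  using assms by (induction L arbitrary: f) (auto intro: locally_L1_step_diff locally_L1_step_avg)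

lemma integrable_mult_test_function:
  assumes "locally_L1 f" "\<psi> \<in> borel_measurable borel" "\<And>x. norm (\<psi> x) \<le> B" "\<And>x. norm x > R \<Longrightarrow> \<psi> x = 0"
  shows "integrable lborel (\<lambda>x. f x * \<psi> x)"
proof (rule integrableI_bounded)
  have f[measurable]: "f \<in> borel_measurable borel" using assms by (simp add: locally_L1_def)
  note assms(2)[measurable]
  show "(\<lambda>x. f x * \<psi> x) \<in> borel_measurable lborel" by measurable
  have "B \<ge> 0" using assms(3)[of 0] norm_ge_zero order.trans by blast
  have "(\<integral>\<^sup>+x. ennreal (norm (f x * \<psi> x)) \<partial>lborel) \<le>
      (\<integral>\<^sup>+x. ennreal B * (ennreal (norm (f x)) * indicator (cball 0 R) x) \<partial>lborel)"
  proof (intro nn_integral_mono)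
    fix x
    show "ennreal (norm (f x * \<psi> x)) \<le> ennreal B * (ennreal (norm (f x)) * indicator (cball 0 R) x)"
      using assms(3)[of x] assms(4)[of x] \<open>B \<ge> 0\<close>
      by (cases "norm x \<le> R")
        (auto simp: norm_mult ennreal_mult[symmetric] mult.commute[of B] intro!: ennreal_leI mult_left_mono)
  qed
  also have "\<dots> = ennreal B * (\<integral>\<^sup>+x. ennreal (norm (f x)) * indicator (cball 0 R) x \<partial>lborel)"
    by (intro nn_integral_cmult) measurable
  also have "\<dots> < \<infinity>"
    using assms(1) by (auto simp: locally_L1_def ennreal_mult_less_top)
  finally show "(\<integral>\<^sup>+x. ennreal (norm (f x * \<psi> x)) \<partial>lborel) < \<infinity>" .
qed

lemma integrable_locally_L1_test_function:
  assumes "locally_L1 f" "test_function \<psi>"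
  shows "integrable lborel (\<lambda>x. f x * \<psi> x)"
  using integrable_mult_test_function[OF assms(1) borel_measurable_test_function[OF assms(2)]]
    test_function_bounded[OF assms(2)] test_function_support[OF assms(2)] by metis

lemma step_diff_pairing:
  assumes "locally_L1 f" "test_function \<psi>"
  shows "(LINT x|lborel. step_diff h t f x * \<psi> x) = (LINT x|lborel. f x * step_diff (- h) t \<psi> x)"
proof -
  have f[measurable]: "f \<in> borel_measurable borel" using assms by (simp add: locally_L1_def)
  have \<psi>[measurable]: "\<psi> \<in> borel_measurable borel" using assms by (intro borel_measurable_test_function)
  define v :: "real^'a" where "v = h *\<^sub>R axis t 1"
  have 1: "integrable lborel (\<lambda>x. f x * \<psi> x)"
    by (rule integrable_locally_L1_test_function[OF assms])
  \<comment> \<open>Integrability against the translate \<psi> (x + v) comes from \<psi> (x + v) =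
    \<psi> x - \<open>step_diff (- h) t \<psi> x\<close>, where both terms are test
    functions.\<close>
  have "integrable lborel (\<lambda>x. f x * step_diff (- h) t \<psi> x)"
    by (intro integrable_locally_L1_test_function test_function_step_diff assms)
  from Bochner_Integration.integrable_diff[OF 1 this]
  have 2: "integrable lborel (\<lambda>x. f x * \<psi> (x + v))"
    by (simp add: step_diff_def algebra_simps v_def)
  have 3: "(LINT x|lborel. f (x - v) * \<psi> x) = (LINT x|lborel. f x * \<psi> (x + v))"
    "integrable lborel (\<lambda>x. f (x - v) * \<psi> x)"
    using integral_lborel_translate[of "\<lambda>x. f (x - v) * \<psi> x" v] 2 by auto
  have "(LINT x|lborel. step_diff h t f x * \<psi> x) = (LINT x|lborel. f x * \<psi> x - f (x - v) * \<psi> x)"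
    by (simp add: step_diff_def algebra_simps v_def)
  also have "\<dots> = (LINT x|lborel. f x * \<psi> x - f x * \<psi> (x + v))"
    using 1 2 3 by simp
  also have "\<dots> = (LINT x|lborel. f x * step_diff (- h) t \<psi> x)"
    by (simp add: step_diff_def algebra_simps v_def)
  finally show ?thesis .
qed

text \<open>For fixed s the substitution x -> x + s h e_t moves the shift from f to \<psi> and
  reverses its sign; Fubini integrates this over s. Absolute integrability on the product comes from
  the bounded support of \<psi> and the local bound on f.\<close>

lemma step_avg_pairing:
  assumes "locally_L1 f" "test_function \<psi>"
  shows "(LINT x|lborel. step_avg h t f x * \<psi> x) = (LINT x|lborel. f x * step_avg (- h) t \<psi> x)"
proof -
  have f[measurable]: "f \<in> borel_measurable borel" using assms by (simp add: locally_L1_def)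
  have \<psi>[measurable]: "\<psi> \<in> borel_measurable borel" using assms by (intro borel_measurable_test_function)
  obtain R where R: "\<And>x. norm x > R \<Longrightarrow> \<psi> x = 0"
    using test_function_support[OF assms(2)] by blast
  obtain B where B: "\<And>x. norm (\<psi> x) \<le> B"
    using test_function_bounded[OF assms(2)] by blast
  then have "B \<ge> 0" using norm_ge_zero order.trans by blast
  define v :: "real \<Rightarrow> real^'a" where "v = (\<lambda>s. (s * h) *\<^sub>R axis t 1)"
  have v[measurable]: "v \<in> borel_measurable borel" unfolding v_def by measurable
  let ?F = "\<lambda>x s. indicator {0..1::real} s *\<^sub>R (f (x - v s) * \<psi> x)"
  let ?C = "\<integral>\<^sup>+x. ennreal (norm (f x)) * indicator (cball 0 (R + \<bar>h\<bar>)) x \<partial>lborel"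
  have meas: "case_prod ?F \<in> borel_measurable (lborel \<Otimes>\<^sub>M lborel)"
    unfolding split_beta by measurable
  have int: "integrable (lborel \<Otimes>\<^sub>M lborel) (case_prod ?F)"
  proof (rule integrableI_bounded[OF meas])
    have "(\<integral>\<^sup>+z. ennreal (norm (case_prod ?F z)) \<partial>(lborel \<Otimes>\<^sub>M lborel)) =
        (\<integral>\<^sup>+s. (\<integral>\<^sup>+x. ennreal (norm (?F x s)) \<partial>lborel) \<partial>lborel)"
      by (subst lborel_pair.nn_integral_snd[symmetric]) (use meas in auto)
    also have "\<dots> \<le> (\<integral>\<^sup>+s. indicator {0..1::real} s * (ennreal B * ?C) \<partial>lborel)"
    proof (intro nn_integral_mono)
      fix s :: real
      have "(\<integral>\<^sup>+x. ennreal (norm (f (x - v s) * \<psi> x)) \<partial>lborel) \<le> ennreal B * ?C" if s: "s \<in> {0..1}"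
      proof -
        have "(\<integral>\<^sup>+x. ennreal (norm (f (x - v s) * \<psi> x)) \<partial>lborel) \<le>
          (\<integral>\<^sup>+x. ennreal B * (ennreal (norm (f (x - v s))) * indicator (cball 0 R) x) \<partial>lborel)"
        proof (intro nn_integral_mono)
          fix x
          show "ennreal (norm (f (x - v s) * \<psi> x)) \<le> ennreal B * (ennreal (norm (f (x - v s))) * indicator (cball 0 R) x)"
            using B[of x] R[of x] \<open>B \<ge> 0\<close>
            by (cases "norm x \<le> R")
              (auto simp: norm_mult ennreal_mult[symmetric] mult.commute[of B] intro!: ennreal_leI mult_left_mono)
        qed
        also have "\<dots> = ennreal B * (\<integral>\<^sup>+x. ennreal (norm (f (x - v s))) * indicator (cball 0 R) x \<partial>lborel)"
          by (intro nn_integral_cmult) measurable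
        also have "\<dots> \<le> ennreal B * ?C"
          using s by (intro mult_left_mono nn_integral_cball_translate) (auto simp: v_def abs_mult mult_left_le_one_le)
        finally show ?thesis .
      qed
      then show "(\<integral>\<^sup>+x. ennreal (norm (?F x s)) \<partial>lborel) \<le> indicator {0..1::real} s * (ennreal B * ?C)"
        by (auto simp: indicator_def)
    qed
    also have "\<dots> = ennreal B * ?C"
      by (subst nn_integral_multc) auto
    also have "\<dots> < \<infinity>"
      using assms(1) by (auto simp: locally_L1_def ennreal_mult_less_top)
    finally show "(\<integral>\<^sup>+z. ennreal (norm (case_prod ?F z)) \<partial>(lborel \<Otimes>\<^sub>M lborel)) < \<infinity>" .
  qed
  \<comment> \<open>\<open>?G\<close> is \<open>?F\<close> translated in x by \<open>v s\<close>.
    For each s both have the same absolute integral over x, so the integrability of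
    \<open>?F\<close> carries over.\<close>
  let ?G = "\<lambda>x s. indicator {0..1::real} s *\<^sub>R (f x * \<psi> (x + v s))"
  have measG: "case_prod ?G \<in> borel_measurable (lborel \<Otimes>\<^sub>M lborel)"
    unfolding split_beta by measurable
  have shift: "(\<integral>\<^sup>+x. ennreal (norm (?G x s)) \<partial>lborel) = (\<integral>\<^sup>+x. ennreal (norm (?F x s)) \<partial>lborel)" for s
    using nn_integral_lborel_translate[of "\<lambda>x. ennreal (norm (?F x s))" "v s"] by simp
  have intG: "integrable (lborel \<Otimes>\<^sub>M lborel) (case_prod ?G)"
  proof (rule integrableI_bounded[OF measG])
    have "(\<integral>\<^sup>+z. ennreal (norm (case_prod ?G z)) \<partial>(lborel \<Otimes>\<^sub>M lborel)) =
        (\<integral>\<^sup>+s. (\<integral>\<^sup>+x. ennreal (norm (?G x s)) \<partial>lborel) \<partial>lborel)"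
      by (subst lborel_pair.nn_integral_snd[symmetric]) (use measG in auto)
    also have "\<dots> = (\<integral>\<^sup>+s. (\<integral>\<^sup>+x. ennreal (norm (?F x s)) \<partial>lborel) \<partial>lborel)"
      by (simp only: shift)
    also have "\<dots> = (\<integral>\<^sup>+z. ennreal (norm (case_prod ?F z)) \<partial>(lborel \<Otimes>\<^sub>M lborel))"
      by (subst lborel_pair.nn_integral_snd[symmetric]) (use meas in auto)
    also have "\<dots> < \<infinity>"
      using int unfolding integrable_iff_bounded by blast
    finally show "(\<integral>\<^sup>+z. ennreal (norm (case_prod ?G z)) \<partial>(lborel \<Otimes>\<^sub>M lborel)) < \<infinity>" .
  qed
  have "(LINT x|lborel. step_avg h t f x * \<psi> x) = (LINT x|lborel. LINT s|lborel. ?F x s)"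
    unfolding step_avg_def v_def by (simp flip: integral_mult_left_zero)
  also have "\<dots> = (LINT s|lborel. LINT x|lborel. ?F x s)"
    by (rule lborel_pair.Fubini_integral[OF int, symmetric])
  also have "\<dots> = (LINT s|lborel. LINT x|lborel. ?G x s)"
  proof (rule Bochner_Integration.integral_cong[OF refl])
    fix s
    show "(LINT x|lborel. ?F x s) = (LINT x|lborel. ?G x s)"
      using integral_lborel_translate(1)[of "\<lambda>x. ?F x s" "v s"] by auto
  qed
  also have "\<dots> = (LINT x|lborel. LINT s|lborel. ?G x s)"
    by (rule lborel_pair.Fubini_integral[OF intG])
  also have "\<dots> = (LINT x|lborel. f x * step_avg (- h) t \<psi> x)"
    unfolding step_avg_def v_def by (simp flip: integral_mult_right_zero)
  finally show ?thesis .
qed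

text \<open>Taking adjoints reverses the order of composition, which is why \<open>fold\<close> on f
  meets \<open>foldr\<close> on \<psi>; no commutation of the operators is involved.\<close>

lemma fold_step_diff_pairing:
  assumes "locally_L1 f" "test_function \<psi>"
  shows "(LINT x|lborel. fold (step_diff h) L f x * \<psi> x) = (LINT x|lborel. f x * foldr (step_diff (- h)) L \<psi> x)"
  using assms(1)
proof (induction L arbitrary: f)
  case (Cons t L)
  then show ?case
    using step_diff_pairing[OF Cons.prems test_function_foldr_step_diff[OF assms(2)]]
    by (simp add: locally_L1_step_diff)
qed simp

lemma fold_step_avg_pairing:
  assumes "locally_L1 f" "test_function \<psi>"
  shows "(LINT x|lborel. fold (step_avg h) L f x * \<psi> x) = (LINT x|lborel. f x * foldr (step_avg (- h)) L \<psi> x)"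
  using assms(1)
proof (induction L arbitrary: f)
  case (Cons t L)
  then show ?case
    using step_avg_pairing[OF Cons.prems test_function_foldr_step_avg[OF assms(2)]]
    by (simp add: locally_L1_step_avg)
qed simp

text \<open>The fundamental lemma of the calculus of variations. Dominated convergence along the
  bump functions makes the integral of u over every box vanish, and Lebesgue's differentiation
  theorem recovers u almost everywhere from its averages over small cubes.\<close>

lemma AE_zero_if_pairing_zero:
  fixes u :: "real^'n::finite \<Rightarrow> complex"
  assumes u: "locally_L1 u" and zero: "\<And>\<psi>. test_function \<psi> \<Longrightarrow> (LINT x|lborel. u x * \<psi> x) = 0"
  shows "AE x in lborel. u x = 0"
proof -
  have [measurable]: "u \<in> borel_measurable borel" using u by (simp add: locally_L1_def)
  have set_int: "set_integrable lborel S u" if S: "S \<in> sets borel" "bounded S" for S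
  proof -
    obtain R where R: "\<And>x. x \<in> S \<Longrightarrow> norm x \<le> R" using S(2) unfolding bounded_iff by blast
    have "integrable lborel (\<lambda>x. u x * indicator S x)"
      using S R by (intro integrable_mult_test_function[OF u, of _ 1 R]) (auto simp: indicator_def not_le[symmetric])
    then show ?thesis
      unfolding set_integrable_def
      by (rule Bochner_Integration.integrable_cong[THEN iffD1, rotated 2]) (auto simp: indicator_def)
  qed
  have int0: "integral (cbox a b) u = 0" for a b
  proof -
    have "(\<lambda>n. LINT x|lborel. u x * complex_of_real (box_bump a b n x)) \<longlonglongrightarrow>
        (LINT x|lborel. indicator (box a b) x *\<^sub>R u x)"
    proof (rule integral_dominated_convergence[where w="\<lambda>x. norm (indicator (box a b) x *\<^sub>R u x)"])
      show "integrable lborel (\<lambda>x. norm (indicator (box a b) x *\<^sub>R u x))"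
        using set_int[of "box a b"] by (intro integrable_norm) (simp add: set_integrable_def)
      show "AE x in lborel. (\<lambda>n. u x * complex_of_real (box_bump a b n x)) \<longlonglongrightarrow> indicator (box a b) x *\<^sub>R u x"
      proof (intro AE_I2)
        fix x
        have "(\<lambda>n. u x * complex_of_real (box_bump a b n x)) \<longlonglongrightarrow> u x * complex_of_real (indicator (box a b) x)"
          by (intro tendsto_intros box_bump_tendsto)
        then show "(\<lambda>n. u x * complex_of_real (box_bump a b n x)) \<longlonglongrightarrow> indicator (box a b) x *\<^sub>R u x"
          by (simp add: scaleR_conv_of_real mult.commute)
      qed
      show "AE x in lborel. norm (u x * complex_of_real (box_bump a b n x)) \<le> norm (indicator (box a b) x *\<^sub>R u x)" for n
        using box_bump_bounds[where a = a and b = b and n = n] by (auto simp: norm_mult mult_left_le split: split_indicator)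
      show "(\<lambda>x. u x * complex_of_real (box_bump a b n x)) \<in> borel_measurable lborel" for n
        using borel_measurable_test_function[OF test_function_box_bump, of a b n] by auto
    qed auto
    then have "(LINT x|lborel. indicator (box a b) x *\<^sub>R u x) = 0"
      by (simp add: zero[OF test_function_box_bump] LIMSEQ_const_iff)
    then have "integral (box a b) u = 0"
      using set_borel_integral_eq_integral(2)[OF set_int[of "box a b"]] by (simp add: set_lebesgue_integral_def)
    then show ?thesis
      by (simp add: integral_open_interval)
  qed
  have "u integrable_on cbox a b" for a b
    by (intro set_borel_integral_eq_integral set_int) auto
  then obtain N where N: "negligible N" and
    lim: "\<And>x e. \<lbrakk>x \<notin> N; 0 < e\<rbrakk> \<Longrightarrow> \<exists>d>0. \<forall>h. 0 < h \<and> h < d \<longrightarrow>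
       norm (integral (cbox x (x + h *\<^sub>R One)) u /\<^sub>R h ^ DIM(real^'n) - u x) < e"
    using integrable_ccontinuous_explicit[of u] by blast
  have "u x = 0" if x: "x \<notin> N" for x
  proof (rule ccontr)
    assume "u x \<noteq> 0"
    then obtain d where "d > 0" and d: "\<And>h. 0 < h \<and> h < d \<Longrightarrow>
       norm (integral (cbox x (x + h *\<^sub>R One)) u /\<^sub>R h ^ DIM(real^'n) - u x) < norm (u x)"
      using lim[OF x, of "norm (u x)"] by auto
    \<comment> \<open>Since the average over the cube is 0, the inequality reads
      \<open>norm (u x) < norm (u x)\<close>.\<close>
    then show False
      using d[of "d / 2"] by (simp add: int0)
  qed
  then have "AE x in lebesgue. u x = 0"
    using N by (intro AE_I'[of N]) (auto simp: negligible_iff_null_sets)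
  then show ?thesis
    by (simp add: AE_completion_iff)
qed


section \<open>Jensen's inequality and Lebesgue norms\<close>

lemma powr_tangent:
  fixes F c p :: real
  assumes "p \<ge> 1" "F \<ge> 0" "c > 0"
  shows "p * F \<le> c powr (1 - p) * F powr p + (p - 1) * c"
proof (cases "F = 0")
  case False
  have "(F powr p * c powr (1 - p)) powr (1 / p) * c powr (1 - 1 / p) \<le>
      1 / p * (F powr p * c powr (1 - p)) + (1 - 1 / p) * c"
    using assms False by (intro Youngs_inequality_0) (auto simp: field_simps)
  moreover have "(F powr p * c powr (1 - p)) powr (1 / p) * c powr (1 - 1 / p) = F"
    using assms False by (simp add: powr_mult powr_powr mult.assoc flip: powr_add) (simp add: diff_divide_distrib)
  ultimately have "p * F \<le> p * (1 / p * (F powr p * c powr (1 - p)) + (1 - 1 / p) * c)"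
    using assms by (intro mult_left_mono) auto
  also have "\<dots> = c powr (1 - p) * F powr p + (p - 1) * c"
    using assms by (simp add: distrib_left left_diff_distrib right_diff_distrib)
  finally show ?thesis .
qed (use assms in auto)

text \<open>
  Jensen's inequality for the weight \<open>w\<close>. It follows from integrating the tangent line
  inequality for \<open>\<lambda>F. F powr p\<close> at the point \<open>r / W\<close>.
\<close>

lemma nn_integral_weighted_powr:
  fixes F :: "'a \<Rightarrow> real" and p r W :: real
  assumes p: "p \<ge> 1" and F: "\<And>x. F x \<ge> 0" and [measurable]: "F \<in> borel_measurable M" "w \<in> borel_measurable M"
    and W: "W \<ge> 0" "(\<integral>\<^sup>+x. w x \<partial>M) \<le> ennreal W"
    and r: "r \<ge> 0" "ennreal r \<le> (\<integral>\<^sup>+x. ennreal (F x) * w x \<partial>M)"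
  shows "ennreal (r powr p) \<le> (\<integral>\<^sup>+x. ennreal (F x powr p) * w x \<partial>M) * ennreal (W powr (p - 1))"
proof (cases "r = 0")
  case False
  with r have "r > 0" by simp
  have "W \<noteq> 0"
  proof
    assume "W = 0"
    then have "(\<integral>\<^sup>+x. w x \<partial>M) = 0" using W by simp
    then have "AE x in M. w x = 0" by (subst (asm) nn_integral_0_iff_AE) auto
    then have "(\<integral>\<^sup>+x. ennreal (F x) * w x \<partial>M) = 0" by (subst nn_integral_0_iff_AE) auto
    then show False using r \<open>r > 0\<close> by simp
  qed
  with W have "W > 0" by simp
  let ?A = "\<integral>\<^sup>+x. ennreal (F x powr p) * w x \<partial>M"
  show ?thesis
  proof (cases ?A)
    case (real A)
    define c where "c = r / W"
    have "c > 0" using \<open>r > 0\<close> \<open>W > 0\<close> by (simp add: c_def)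
    have "ennreal (p * r) \<le> ennreal p * (\<integral>\<^sup>+x. ennreal (F x) * w x \<partial>M)"
      using p r by (simp add: ennreal_mult mult_left_mono)
    also have "\<dots> = (\<integral>\<^sup>+x. ennreal (p * F x) * w x \<partial>M)"
      using p F by (subst nn_integral_cmult[symmetric]) (auto simp: ennreal_mult mult.assoc)
    also have "\<dots> \<le> (\<integral>\<^sup>+x. ennreal (c powr (1 - p)) * (ennreal (F x powr p) * w x) + ennreal ((p - 1) * c) * w x \<partial>M)"
    proof (intro nn_integral_mono)
      fix x
      have "ennreal (p * F x) \<le> ennreal (c powr (1 - p) * F x powr p + (p - 1) * c)"
        by (intro ennreal_leI powr_tangent p F \<open>c > 0\<close>)
      also have "\<dots> = ennreal (c powr (1 - p)) * ennreal (F x powr p) + ennreal ((p - 1) * c)"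
        using p \<open>c > 0\<close> by (simp add: ennreal_mult ennreal_plus)
      finally have "ennreal (p * F x) * w x \<le>
          (ennreal (c powr (1 - p)) * ennreal (F x powr p) + ennreal ((p - 1) * c)) * w x"
        by (intro mult_right_mono) auto
      then show "ennreal (p * F x) * w x \<le>
          ennreal (c powr (1 - p)) * (ennreal (F x powr p) * w x) + ennreal ((p - 1) * c) * w x"
        by (simp add: distrib_right mult.assoc)
    qed
    also have "\<dots> = ennreal (c powr (1 - p)) * ?A + ennreal ((p - 1) * c) * (\<integral>\<^sup>+x. w x \<partial>M)"
      by (subst nn_integral_add) (auto simp: nn_integral_cmult)
    also have "\<dots> \<le> ennreal (c powr (1 - p)) * ennreal A + ennreal ((p - 1) * c) * ennreal W"
      using W real by (intro add_mono mult_left_mono) auto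
    also have "\<dots> = ennreal (c powr (1 - p) * A + (p - 1) * c * W)"
      using p W real \<open>c > 0\<close> by (simp add: ennreal_mult ennreal_plus)
    finally have "p * r \<le> c powr (1 - p) * A + (p - 1) * c * W"
      using p W real \<open>c > 0\<close> by (subst (asm) ennreal_le_iff) auto
    moreover have "(p - 1) * c * W = (p - 1) * r"
      using \<open>W > 0\<close> by (simp add: c_def)
    ultimately have "r \<le> c powr (1 - p) * A"
      by (simp add: left_diff_distrib)
    then have "r * r powr (p - 1) \<le> c powr (1 - p) * A * r powr (p - 1)"
      by (intro mult_right_mono) auto
    also have "c powr (1 - p) = W powr (p - 1) / r powr (p - 1)"
      using \<open>r > 0\<close> \<open>W > 0\<close> by (simp add: c_def powr_divide powr_diff field_simps)
    finally have "r powr p \<le> A * W powr (p - 1)"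
      using \<open>r > 0\<close> by (simp add: powr_diff field_simps)
    then show ?thesis
      using real by (simp add: ennreal_mult[symmetric] ennreal_leI)
  next
    case top
    then show ?thesis using \<open>W > 0\<close> by (simp add: ennreal_top_mult)
  qed
qed (use p in simp)

lemma enn2real_ge_1: "1 \<le> p \<Longrightarrow> p \<noteq> \<infinity> \<Longrightarrow> 1 \<le> enn2real p"
  by (cases p) auto

text \<open>Extracts p-th roots once and for all. Two measures appear because norms of sequences
  will be compared with norms of functions.\<close>

lemma Lp_norm_le_finite:
  assumes p: "1 \<le> p" "p \<noteq> \<infinity>" and C: "0 \<le> C"
    and le: "(\<integral>\<^sup>+x. ennreal (norm (f x) powr enn2real p) \<partial>M) \<le>
      ennreal (C powr enn2real p) * (\<integral>\<^sup>+x. ennreal (norm (g x) powr enn2real p) \<partial>N)"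
  shows "Lp_norm p M f \<le> ennreal C * Lp_norm p N g"
proof -
  define P where "P = enn2real p"
  have P: "P \<ge> 1" using p by (simp add: P_def enn2real_ge_1)
  define I where "I = (\<integral>\<^sup>+x. ennreal (norm (f x) powr P) \<partial>M)"
  define J where "J = (\<integral>\<^sup>+x. ennreal (norm (g x) powr P) \<partial>N)"
  have IJ: "I \<le> ennreal (C powr P) * J" using le by (simp add: I_def J_def P_def)
  have f: "Lp_norm p M f = (if I = \<infinity> then \<infinity> else ennreal (enn2real I powr (1 / P)))"
    and g: "Lp_norm p N g = (if J = \<infinity> then \<infinity> else ennreal (enn2real J powr (1 / P)))"
    using p by (auto simp: Lp_norm_def I_def J_def P_def Let_def)
  \<comment> \<open>In the first case the bound is 0 times \<infinity>, which is 0, both in the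
    hypothesis and in the conclusion; so the left side must vanish.\<close>
  consider "J = \<infinity>" "C = 0" | "J = \<infinity>" "C > 0" | j where "J = ennreal j" "j \<ge> 0"
    using C by (cases J) fastforce+
  then show ?thesis
  proof cases
    case 1
    then have "I = 0" using IJ P by simp
    then show ?thesis using P by (simp add: f)
  next
    case 2
    then show ?thesis by (simp add: g ennreal_mult_top)
  next
    case 3
    then have "I \<le> ennreal (C powr P * j)" using IJ by (simp add: ennreal_mult)
    then obtain i where i: "I = ennreal i" "0 \<le> i" "i \<le> C powr P * j"
      using 3 by (cases I) (auto simp: top_unique)
    have "i powr (1 / P) \<le> (C powr P * j) powr (1 / P)"
      using i P by (intro powr_mono2) auto
    also have "\<dots> = C * j powr (1 / P)"
      using C P 3 by (simp add: powr_mult powr_powr)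
    finally show ?thesis
      using i 3 C by (simp add: f g ennreal_mult[symmetric] ennreal_leI)
  qed
qed

lemma Lp_norm_infinity: "Lp_norm \<infinity> M f = esssup M (\<lambda>x. ennreal (norm (f x)))"
  by (simp add: Lp_norm_def)

lemma Lp_norm_le_infinity:
  assumes "f \<in> borel_measurable M" "AE x in M. ennreal (norm (f x)) \<le> C * Lp_norm \<infinity> N g"
  shows "Lp_norm \<infinity> M f \<le> C * Lp_norm \<infinity> N g"
  using assms by (subst Lp_norm_infinity) (intro esssup_I, measurable)

lemma Lp_norm_cong_AE:
  assumes [measurable]: "f \<in> borel_measurable M" "g \<in> borel_measurable M" and "AE x in M. f x = g x"
  shows "Lp_norm p M f = Lp_norm p M g"
proof -
  have "(\<integral>\<^sup>+x. ennreal (norm (f x) powr enn2real p) \<partial>M) = (\<integral>\<^sup>+x. ennreal (norm (g x) powr enn2real p) \<partial>M)"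
    using assms(3) by (intro nn_integral_cong_AE) auto
  moreover have "esssup M (\<lambda>x. ennreal (norm (f x))) = esssup M (\<lambda>x. ennreal (norm (g x)))"
    using assms(3) by (intro esssup_AE_cong) auto
  ultimately show ?thesis by (simp add: Lp_norm_def)
qed

lemma Lp_norm_cmult_le:
  assumes "1 \<le> p" and [measurable]: "f \<in> borel_measurable M"
  shows "Lp_norm p M (\<lambda>x. c * f x) \<le> ennreal (norm c) * Lp_norm p M f"
proof (cases "p = \<infinity>")
  case True
  have "AE x in M. ennreal (norm (c * f x)) \<le> ennreal (norm c) * Lp_norm \<infinity> M f"
    unfolding Lp_norm_infinity
    using esssup_AE[of "\<lambda>x. ennreal (norm (f x))" M]
    by eventually_elim (simp add: norm_mult ennreal_mult mult_left_mono)
  then show ?thesis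
    unfolding True by (intro Lp_norm_le_infinity) measurable
next
  case False
  show ?thesis
    using False assms(1)
    by (intro Lp_norm_le_finite) (auto simp: norm_mult powr_mult ennreal_mult nn_integral_cmult)
qed

section \<open>Affine changes of variables, and averages on Lebesgue spaces\<close>

lemma AE_lborel_affine:
  fixes t :: "'a::euclidean_space"
  assumes "c \<noteq> 0" "AE x in lborel. P x"
  shows "AE x in lborel. P (t + c *\<^sub>R x)"
proof -
  have "AE x in density (distr lborel borel (\<lambda>x. t + c *\<^sub>R x)) (\<lambda>_. \<bar>c\<bar>^DIM('a)). P x"
    by (subst lborel_affine[OF assms(1), symmetric]) (rule assms(2))
  then have "AE x in distr lborel borel (\<lambda>x. t + c *\<^sub>R x). P x"
    using assms(1) by (subst (asm) AE_density) auto
  then show ?thesis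
    by (rule AE_distrD[rotated]) simp
qed

lemma nn_integral_lborel_affine:
  fixes t :: "'a::euclidean_space"
  assumes "c \<noteq> 0" and [measurable]: "f \<in> borel_measurable borel"
  shows "(\<integral>\<^sup>+x. f x \<partial>lborel) = ennreal (\<bar>c\<bar> ^ DIM('a)) * (\<integral>\<^sup>+x. f (t + c *\<^sub>R x) \<partial>lborel)"
proof -
  have "(\<integral>\<^sup>+x. f x \<partial>lborel) =
      (\<integral>\<^sup>+x. f x \<partial>density (distr lborel borel (\<lambda>x. t + c *\<^sub>R x)) (\<lambda>_. \<bar>c\<bar>^DIM('a)))"
    using lborel_affine[OF assms(1), of t] by simp
  then show ?thesis
    by (simp add: nn_integral_density nn_integral_distr nn_integral_cmult)
qed

text \<open>For finite p this is Jensen for the uniform weight on [0,1], then Tonelli and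
  translation invariance. The constant 1 is the mass of that weight.\<close>

lemma Lp_norm_step_avg:
  fixes f :: "real^'n::finite \<Rightarrow> complex"
  assumes p: "1 \<le> p" and [measurable]: "f \<in> borel_measurable borel"
  shows "Lp_norm p lborel (step_avg h t f) \<le> Lp_norm p lborel f"
proof -
  define v :: "real \<Rightarrow> real^'n" where "v = (\<lambda>s. (s * h) *\<^sub>R axis t 1)"
  have v[measurable]: "v \<in> borel_measurable borel" unfolding v_def by measurable
  have avg_le: "ennreal (norm (step_avg h t f x)) \<le>
      (\<integral>\<^sup>+s. ennreal (norm (f (x - v s))) * indicator {0..1} s \<partial>lborel)" for x
  proof -
    have "ennreal (norm (step_avg h t f x)) \<le>
        (\<integral>\<^sup>+s. ennreal (norm (indicator {0..1::real} s *\<^sub>R f (x - v s))) \<partial>lborel)"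
      unfolding step_avg_def v_def by (rule norm_integral_le_nn_integral)
    also have "\<dots> = (\<integral>\<^sup>+s. ennreal (norm (f (x - v s))) * indicator {0..1} s \<partial>lborel)"
      by (intro nn_integral_cong) (auto simp: indicator_def)
    finally show ?thesis .
  qed
  have "Lp_norm p lborel (step_avg h t f) \<le> ennreal 1 * Lp_norm p lborel f"
  proof (cases "p = \<infinity>")
    case True
    define E where "E = Lp_norm \<infinity> lborel f"
    have "AE x in lborel. ennreal (norm (f x)) \<le> E"
      unfolding E_def Lp_norm_infinity by (rule esssup_AE)
    then have "AE x in lborel. ennreal (norm (f (x - v s))) \<le> E" for s
      using AE_lborel_affine[of 1 _ "- v s"] by (simp add: algebra_simps)
    \<comment> \<open>The exceptional null set of x depends on s. Fubini for null sets exchanges the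
      quantifiers, so that for almost every x the bound holds along almost all of the
      segment.\<close>
    then have "AE s in lborel. AE x in lborel. ennreal (norm (f (x - v s))) \<le> E" by simp
    then have "AE x in lborel. AE s in lborel. ennreal (norm (f (x - v s))) \<le> E"
      by (subst lborel_pair.AE_commute) measurable
    then have "AE x in lborel. ennreal (norm (step_avg h t f x)) \<le> E"
    proof eventually_elim
      case (elim x)
      have "(\<integral>\<^sup>+s. ennreal (norm (f (x - v s))) * indicator {0..1} s \<partial>lborel) \<le>
          (\<integral>\<^sup>+s. E * indicator {0..1::real} s \<partial>lborel)"
        using elim by (intro nn_integral_mono_AE) (auto elim!: eventually_mono intro!: mult_right_mono)
      also have "\<dots> = E" by (subst nn_integral_cmult) auto
      finally show ?case using avg_le[of x] by order
    qed
    then show ?thesis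
      unfolding True by (intro Lp_norm_le_infinity) (auto simp: E_def)
  next
    case False
    define P where "P = enn2real p"
    have P: "P \<ge> 1" using p False by (simp add: P_def enn2real_ge_1)
    have "(\<integral>\<^sup>+x. ennreal (norm (step_avg h t f x) powr P) \<partial>lborel) \<le>
        (\<integral>\<^sup>+x. (\<integral>\<^sup>+s. ennreal (norm (f (x - v s)) powr P) * indicator {0..1} s \<partial>lborel) \<partial>lborel)"
    proof (intro nn_integral_mono)
      fix x
      have "ennreal (norm (step_avg h t f x) powr P) \<le>
          (\<integral>\<^sup>+s. ennreal (norm (f (x - v s)) powr P) * indicator {0..1} s \<partial>lborel) * ennreal (1 powr (P - 1))"
        by (rule nn_integral_weighted_powr[OF P]) (use avg_le in auto)
      then show "ennreal (norm (step_avg h t f x) powr P) \<le>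
          (\<integral>\<^sup>+s. ennreal (norm (f (x - v s)) powr P) * indicator {0..1} s \<partial>lborel)" by simp
    qed
    also have "\<dots> = (\<integral>\<^sup>+s. (\<integral>\<^sup>+x. ennreal (norm (f (x - v s)) powr P) * indicator {0..1} s \<partial>lborel) \<partial>lborel)"
      by (rule lborel_pair.Fubini'[symmetric]) (unfold split_beta, measurable)
    also have "\<dots> = (\<integral>\<^sup>+s. (\<integral>\<^sup>+x. ennreal (norm (f x) powr P) \<partial>lborel) * indicator {0..1::real} s \<partial>lborel)"
    proof (rule nn_integral_cong)
      fix s
      show "(\<integral>\<^sup>+x. ennreal (norm (f (x - v s)) powr P) * indicator {0..1} s \<partial>lborel) =
          (\<integral>\<^sup>+x. ennreal (norm (f x) powr P) \<partial>lborel) * indicator {0..1::real} s"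
        using nn_integral_lborel_translate[of "\<lambda>x. ennreal (norm (f x) powr P)" "- v s"]
        by (simp add: nn_integral_multc)
    qed
    also have "\<dots> = (\<integral>\<^sup>+x. ennreal (norm (f x) powr P) \<partial>lborel)"
      by (subst nn_integral_cmult) auto
    finally show ?thesis
      using False p by (intro Lp_norm_le_finite) (auto simp: P_def)
  qed
  then show ?thesis by simp
qed

lemma borel_measurable_fold_step_avg [measurable]:
  "f \<in> borel_measurable borel \<Longrightarrow> fold (step_avg h) L f \<in> borel_measurable borel"
  by (induction L arbitrary: f) auto

lemma Lp_norm_fold_step_avg:
  assumes "1 \<le> p" "f \<in> borel_measurable borel"
  shows "Lp_norm p lborel (fold (step_avg h) L f) \<le> Lp_norm p lborel f"
  using assms(2)
proof (induction L arbitrary: f)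
  case (Cons t L)
  have "Lp_norm p lborel (fold (step_avg h) L (step_avg h t f)) \<le> Lp_norm p lborel (step_avg h t f)"
    using Cons.prems by (intro Cons.IH) measurable
  also have "\<dots> \<le> Lp_norm p lborel f"
    by (intro Lp_norm_step_avg assms(1) Cons.prems)
  finally show ?case by simp
qed simp


section \<open>Weak derivatives and step differences\<close>

lemma locally_L1_diff_cmult:
  assumes "locally_L1 f" "locally_L1 g"
  shows "locally_L1 (\<lambda>x. f x - c * g x)"
proof -
  have [measurable]: "f \<in> borel_measurable borel" "g \<in> borel_measurable borel"
    using assms by (simp_all add: locally_L1_def)
  have "(\<integral>\<^sup>+x. ennreal (norm (f x - c * g x)) * indicator (cball 0 R) x \<partial>lborel) < \<infinity>" for R
  proof -
    have "(\<integral>\<^sup>+x. ennreal (norm (f x - c * g x)) * indicator (cball 0 R) x \<partial>lborel) \<le>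
       (\<integral>\<^sup>+x. ennreal (norm (f x)) * indicator (cball 0 R) x +
          ennreal (norm c) * (ennreal (norm (g x)) * indicator (cball 0 R) x) \<partial>lborel)"
    proof (intro nn_integral_mono)
      fix x
      have "ennreal (norm (f x - c * g x)) \<le> ennreal (norm (f x) + norm c * norm (g x))"
        by (intro ennreal_leI) (metis norm_mult norm_triangle_ineq4)
      then show "ennreal (norm (f x - c * g x)) * indicator (cball 0 R) x \<le>
          ennreal (norm (f x)) * indicator (cball 0 R) x +
          ennreal (norm c) * (ennreal (norm (g x)) * indicator (cball 0 R) x)"
        by (simp add: indicator_def ennreal_plus ennreal_mult)
    qed
    also have "\<dots> = (\<integral>\<^sup>+x. ennreal (norm (f x)) * indicator (cball 0 R) x \<partial>lborel) +
       ennreal (norm c) * (\<integral>\<^sup>+x. ennreal (norm (g x)) * indicator (cball 0 R) x \<partial>lborel)"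
      by (subst nn_integral_add) (auto simp: nn_integral_cmult)
    also have "\<dots> < \<infinity>"
      using assms by (auto simp: locally_L1_def ennreal_mult_less_top)
    finally show ?thesis .
  qed
  then show ?thesis by (simp add: locally_L1_def)
qed

lemma AE_step_diff_eq_step_avg:
  fixes f g :: "real^'n::finite \<Rightarrow> complex"
  assumes f: "locally_L1 f" and g: "locally_L1 g"
    and weak: "\<And>\<psi>. test_function \<psi> \<Longrightarrow> (LINT x|lborel. f x * foldr partial_deriv L \<psi> x) =
      (-1) ^ length L * (LINT x|lborel. g x * \<psi> x)"
  shows "AE x in lborel. fold (step_diff h) L f x = complex_of_real h ^ length L * fold (step_avg h) L g x"
proof -
  let ?F = "fold (step_diff h) L f" and ?G = "fold (step_avg h) L g"
  let ?c = "complex_of_real h ^ length L"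
  have F: "locally_L1 ?F" and G: "locally_L1 ?G"
    using f g by (auto intro: locally_L1_fold)
  have "AE x in lborel. ?F x - ?c * ?G x = 0"
  proof (rule AE_zero_if_pairing_zero)
    show "locally_L1 (\<lambda>x. ?F x - ?c * ?G x)"
      by (intro locally_L1_diff_cmult F G)
    fix \<psi> :: "real^'n \<Rightarrow> complex"
    assume \<psi>: "test_function \<psi>"
    define \<Psi> where "\<Psi> = foldr (step_avg (- h)) L \<psi>"
    have \<Psi>: "test_function \<Psi>" unfolding \<Psi>_def by (intro test_function_foldr_step_avg \<psi>)
    have sm: "smooth \<psi>" using \<psi> by (simp add: test_function_def)
    have "(LINT x|lborel. ?F x * \<psi> x) = (LINT x|lborel. f x * foldr (step_diff (- h)) L \<psi> x)"
      by (rule fold_step_diff_pairing[OF f \<psi>])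
    also have "\<dots> = (LINT x|lborel. complex_of_real (- h) ^ length L * (f x * foldr partial_deriv L \<Psi> x))"
      unfolding foldr_step_diff_eq_step_avg[OF sm] \<Psi>_def by (simp only: mult.left_commute)
    also have "\<dots> = complex_of_real (- h) ^ length L * ((-1) ^ length L * (LINT x|lborel. g x * \<Psi> x))"
      by (simp only: integral_mult_right_zero weak[OF \<Psi>])
    \<comment> \<open>The sign of the adjoint step -h cancels the sign of the weak derivative:
      (-h)^n (-1)^n = h^n.\<close>
    also have "\<dots> = ?c * (LINT x|lborel. g x * \<Psi> x)"
      by (simp flip: power_mult_distrib mult.assoc)
    also have "(LINT x|lborel. g x * \<Psi> x) = (LINT x|lborel. ?G x * \<psi> x)"
      unfolding \<Psi>_def by (rule fold_step_avg_pairing[OF g \<psi>, symmetric])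
    finally have *: "(LINT x|lborel. ?F x * \<psi> x) = ?c * (LINT x|lborel. ?G x * \<psi> x)" .
    have "integrable lborel (\<lambda>x. ?F x * \<psi> x)" "integrable lborel (\<lambda>x. ?G x * \<psi> x)"
      by (intro integrable_locally_L1_test_function F G \<psi>)+
    then have "(LINT x|lborel. ?F x * \<psi> x - ?c * (?G x * \<psi> x)) = 0"
      using * by simp
    then show "(LINT x|lborel. (?F x - ?c * ?G x) * \<psi> x) = 0"
      by (simp add: left_diff_distrib mult.assoc)
  qed
  then show ?thesis by simp
qed

text \<open>Differences of sequences are composed by \<open>foldr\<close>, while the pairing
  delivers \<open>fold\<close>. Translations commute, so both orders agree.\<close>

lemma foldr_step_diff_eq_fold: "foldr (step_diff h) L f = fold (step_diff h) L f"
proof -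
  have "step_diff h s (step_diff h t u) = step_diff h t (step_diff h s u)" for s t u
    by (auto simp: step_diff_def fun_eq_iff algebra_simps)
  then show ?thesis
    by (subst foldr_fold) (auto simp: fun_eq_iff)
qed


section \<open>Borel representatives\<close>

lemma lebesgue_borel_representative:
  fixes f :: "real^'n::finite \<Rightarrow> complex"
  assumes [measurable]: "f \<in> borel_measurable lebesgue"
  obtains g where "g \<in> borel_measurable borel" "AE x in lborel. f x = g x"
proof -
  have "(\<lambda>x. Re (f x)) \<in> borel_measurable lebesgue" "(\<lambda>x. Im (f x)) \<in> borel_measurable lebesgue"
    by measurable
  then obtain u v where [measurable]: "u \<in> borel_measurable lborel" "v \<in> borel_measurable lborel"
    and AE: "AE x in lborel. Re (f x) = u x" "AE x in lborel. Im (f x) = v x"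
    using completion_ex_borel_measurable_real[of "\<lambda>x. Re (f x)" lborel]
      completion_ex_borel_measurable_real[of "\<lambda>x. Im (f x)" lborel] by blast
  have "(\<lambda>x. complex_of_real (u x) + \<i> * complex_of_real (v x)) \<in> borel_measurable lborel"
    by measurable
  moreover have "AE x in lborel. f x = complex_of_real (u x) + \<i> * complex_of_real (v x)"
    using AE by eventually_elim (simp add: complex_eq_iff)
  ultimately show thesis
    by (intro that) auto
qed

lemma integral_lebesgue_eq_lborel:
  fixes f g :: "real^'n::finite \<Rightarrow> complex"
  assumes "f \<in> borel_measurable lebesgue" "g \<in> borel_measurable borel" "AE x in lborel. f x = g x"
  shows "(LINT x|lebesgue. f x) = (LINT x|lborel. g x)"
proof -
  have "(LINT x|lebesgue. f x) = (LINT x|lebesgue. g x)"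
    using assms by (intro integral_cong_AE) (auto intro: AE_completion measurable_completion)
  then show ?thesis
    using assms by (simp add: integral_completion)
qed

lemma Lp_norm_lebesgue_eq_lborel:
  fixes f g :: "real^'n::finite \<Rightarrow> complex"
  assumes "f \<in> borel_measurable lebesgue" "g \<in> borel_measurable borel" "AE x in lborel. f x = g x"
  shows "Lp_norm p lebesgue f = Lp_norm p lborel g"
proof -
  have g[measurable]: "g \<in> borel_measurable lborel" "g \<in> borel_measurable lebesgue"
    using assms by (auto intro: measurable_completion)
  have "Lp_norm p lebesgue f = Lp_norm p lebesgue g"
    using assms g by (intro Lp_norm_cong_AE) (auto intro: AE_completion)
  moreover have "esssup lebesgue (\<lambda>x. ennreal (norm (g x))) = esssup lborel (\<lambda>x. ennreal (norm (g x)))"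
    by (subst (1 2) esssup_eq_AE) (auto simp: AE_completion_iff)
  ultimately show ?thesis
    by (simp add: Lp_norm_def nn_integral_completion)
qed

lemma locally_L1_representative:
  fixes f g :: "real^'n::finite \<Rightarrow> complex"
  assumes f: "locally_integrable f" and g: "g \<in> borel_measurable borel" "AE x in lborel. f x = g x"
  shows "locally_L1 g"
  unfolding locally_L1_def
proof (intro conjI allI)
  fix R
  have "set_integrable lebesgue (cball 0 R) f"
    using f unfolding locally_integrable_def by auto
  then have "(\<integral>\<^sup>+x. ennreal (norm (indicator (cball 0 R) x *\<^sub>R f x)) \<partial>lborel) < \<infinity>"
    by (simp add: set_integrable_def integrable_iff_bounded nn_integral_completion)
  moreover have "(\<integral>\<^sup>+x. ennreal (norm (indicator (cball 0 R) x *\<^sub>R f x)) \<partial>lborel) =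
     (\<integral>\<^sup>+x. ennreal (norm (g x)) * indicator (cball 0 R) x \<partial>lborel)"
    by (intro nn_integral_cong_AE eventually_mono[OF g(2)]) (auto simp: indicator_def)
  ultimately show "(\<integral>\<^sup>+x. ennreal (norm (g x)) * indicator (cball 0 R) x \<partial>lborel) < \<infinity>" by simp
qed fact


section \<open>The analysis operator on Lebesgue spaces\<close>

text \<open>Connects the \<open>infsum\<close> in \<open>periodization\<close> with the counting
  measure, for which Tonelli is available. Finite initial pieces of an enumeration exhaust the type,
  and each of their sums is below the \<open>infsum\<close>.\<close>

lemma nn_integral_count_space_le_infsum:
  fixes f :: "'a::countable \<Rightarrow> ennreal"
  shows "(\<integral>\<^sup>+k. f k \<partial>count_space UNIV) \<le> infsum f UNIV"
proof -
  define F where "F n = {k::'a. to_nat k \<le> n}" for n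
  have fin: "finite (F n)" for n
    unfolding F_def using finite_vimageI[of "{..n}" "to_nat :: 'a \<Rightarrow> nat"] by (simp add: vimage_def)
  have "f k = (SUP n. f k * indicator (F n) k)" for k
    by (intro antisym SUP_least) (auto intro!: SUP_upper2[of "to_nat k"] simp: F_def indicator_def)
  then have "(\<integral>\<^sup>+k. f k \<partial>count_space UNIV) = (\<integral>\<^sup>+k. (SUP n. f k * indicator (F n) k) \<partial>count_space UNIV)"
    by simp
  also have "\<dots> = (SUP n. \<integral>\<^sup>+k. f k * indicator (F n) k \<partial>count_space UNIV)"
    by (rule nn_integral_monotone_convergence_SUP) (auto simp: incseq_def le_fun_def indicator_def F_def)
  also have "\<dots> = (SUP n. sum f (F n))"
    by (simp add: nn_integral_count_space_indicator[symmetric] nn_integral_count_space_finite fin)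
  also have "\<dots> \<le> infsum f UNIV"
    by (subst nonneg_infsum_complete) (auto intro!: SUP_least SUP_upper simp: fin)
  finally show ?thesis .
qed

text \<open>Half open, so that every point lies in exactly one integer translate.\<close>

definition unit_cube :: "(real^'n::finite) set"
  where "unit_cube = {x. \<forall>i. 0 \<le> x $ i \<and> x $ i < 1}"

lemma unit_cube_borel [measurable]: "unit_cube \<in> sets borel"
proof -
  have [measurable]: "(\<lambda>x::real^'n. x $ i) \<in> borel_measurable borel" for i
    by (intro borel_measurable_continuous_onI continuous_intros)
  show ?thesis unfolding unit_cube_def by measurable
qed

lemma emeasure_unit_cube: "emeasure lborel (unit_cube :: (real^'n::finite) set) \<le> 1"
proof -
  have "emeasure lborel (unit_cube :: (real^'n) set) \<le> emeasure lborel (cbox 0 (1::real^'n))"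
    by (intro emeasure_mono) (auto simp: unit_cube_def mem_box_cart less_imp_le)
  also have "\<dots> = ennreal (measure lborel (cbox 0 (1::real^'n)))"
    by (intro emeasure_eq_ennreal_measure) (use emeasure_lborel_cbox_finite in \<open>auto simp: top.not_eq_extremum\<close>)
  also have "measure lborel (cbox 0 (1::real^'n)) = 1"
    by (subst content_cbox_cart) (auto simp: interval_ne_empty_cart)
  finally show ?thesis by simp
qed

lemma unit_cube_tiling:
  "(\<integral>\<^sup>+k. indicator unit_cube (x + lattice_point k) \<partial>count_space UNIV) = 1"
proof -
  define k0 :: "int^'a" where "k0 = (\<chi> i. - \<lfloor>x $ i\<rfloor>)"
  have "x + lattice_point k \<in> unit_cube \<longleftrightarrow> k = k0" for k
  proof -
    have "0 \<le> x $ i + real_of_int (k $ i) \<and> x $ i + real_of_int (k $ i) < 1 \<longleftrightarrow> k $ i = - \<lfloor>x $ i\<rfloor>" for i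
      using floor_eq_iff[of "x $ i" "- (k $ i)"] by auto
    then show ?thesis
      by (auto simp: unit_cube_def lattice_point_def k0_def vec_eq_iff)
  qed
  then have "indicator unit_cube (x + lattice_point k) = (indicator {k0} k :: ennreal)" for k
    by (auto simp: indicator_def)
  then show ?thesis by simp
qed

text \<open>The translated cubes form a partition of unity. Inserting it and translating each piece
  back by k turns the integral of f into that of its periodization over a single cube, of volume at
  most 1.\<close>

lemma nn_integral_le_periodization:
  fixes f :: "real^'n::finite \<Rightarrow> ennreal"
  assumes [measurable]: "f \<in> borel_measurable borel"
    and "AE x in lborel. (\<integral>\<^sup>+k. f (x - lattice_point k) \<partial>count_space UNIV) \<le> K"
  shows "(\<integral>\<^sup>+x. f x \<partial>lborel) \<le> K"
proof -
  have "(\<integral>\<^sup>+x. f x \<partial>lborel) =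
      (\<integral>\<^sup>+x. (\<integral>\<^sup>+k. f x * indicator unit_cube (x + lattice_point k) \<partial>count_space UNIV) \<partial>lborel)"
    by (simp add: nn_integral_cmult unit_cube_tiling)
  also have "\<dots> = (\<integral>\<^sup>+k. (\<integral>\<^sup>+x. f x * indicator unit_cube (x + lattice_point k) \<partial>lborel) \<partial>count_space UNIV)"
    by (rule nn_integral_count_space_nn_integral) auto
  also have "\<dots> = (\<integral>\<^sup>+k. (\<integral>\<^sup>+x. f (x - lattice_point k) * indicator unit_cube x \<partial>lborel) \<partial>count_space UNIV)"
    using nn_integral_lborel_translate[of "\<lambda>x. f x * indicator unit_cube (x + lattice_point k)" "- lattice_point k" for k]
    by (simp add: algebra_simps)
  also have "\<dots> = (\<integral>\<^sup>+x. (\<integral>\<^sup>+k. f (x - lattice_point k) * indicator unit_cube x \<partial>count_space UNIV) \<partial>lborel)"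
    by (rule nn_integral_count_space_nn_integral[symmetric]) auto
  also have "\<dots> = (\<integral>\<^sup>+x. (\<integral>\<^sup>+k. f (x - lattice_point k) \<partial>count_space UNIV) * indicator unit_cube x \<partial>lborel)"
    by (simp add: nn_integral_multc)
  also have "\<dots> \<le> (\<integral>\<^sup>+x. K * indicator unit_cube (x::real^'n) \<partial>lborel)"
    using assms(2) by (intro nn_integral_mono_AE) (auto elim!: eventually_mono intro!: mult_right_mono)
  also have "\<dots> = K * emeasure lborel (unit_cube :: (real^'n) set)"
    by (subst nn_integral_cmult_indicator) auto
  also have "\<dots> \<le> K * 1"
    by (intro mult_left_mono emeasure_unit_cube) auto
  finally show ?thesis by simp
qed

lemma borel_measurable_cnj [measurable (raw)]:
  "f \<in> borel_measurable M \<Longrightarrow> (\<lambda>x. cnj (f x)) \<in> borel_measurable M"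
  by (rule borel_measurable_continuous_on[OF continuous_on_cnj[OF continuous_on_id]])

text \<open>The situation at one scale after the passage to a Borel representative of the window. K
  will be the essential supremum of P|\<phi>|; it is a real number so that it can be divided by
  |\<alpha>|^d and raised to powers.\<close>

locale dilated_window =
  fixes \<alpha> :: real and \<phi> :: "real^'n::finite \<Rightarrow> complex" and K :: real
  assumes \<alpha>: "\<alpha> \<noteq> 0" and \<phi> [measurable]: "\<phi> \<in> borel_measurable borel" and K: "0 \<le> K"
    and periodization_le: "AE x in lborel.
      (\<integral>\<^sup>+k. ennreal (norm (\<phi> (x - lattice_point k))) \<partial>count_space UNIV) \<le> ennreal K"
begin

text \<open>The coefficient without the normalising factor |\<alpha>|^(d/q), which is a constant and
  comes back as a scalar multiple.\<close>

definition coeff :: "(real^'n \<Rightarrow> complex) \<Rightarrow> int^'n \<Rightarrow> complex"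
  where "coeff f k = (LINT x|lborel. f x * cnj (\<phi> (\<alpha> *\<^sub>R x - lattice_point k)))"

abbreviation window :: "int^'n \<Rightarrow> real^'n \<Rightarrow> ennreal"
  where "window k x \<equiv> ennreal (norm (\<phi> (\<alpha> *\<^sub>R x - lattice_point k)))"

lemma nn_integral_window: "(\<integral>\<^sup>+x. window k x \<partial>lborel) \<le> ennreal (K / \<bar>\<alpha>\<bar> ^ CARD('n))"
proof -
  have "ennreal (\<bar>\<alpha>\<bar> ^ CARD('n)) * (\<integral>\<^sup>+x. window k x \<partial>lborel) = (\<integral>\<^sup>+x. ennreal (norm (\<phi> x)) \<partial>lborel)"
    using nn_integral_lborel_affine[OF \<alpha>, of "\<lambda>x. ennreal (norm (\<phi> x))" "- lattice_point k"]
    by (simp add: algebra_simps)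
  also have "\<dots> \<le> ennreal K"
    by (intro nn_integral_le_periodization periodization_le) measurable
  finally have "ennreal (\<bar>\<alpha>\<bar> ^ CARD('n)) * (\<integral>\<^sup>+x. window k x \<partial>lborel) \<le> ennreal K" .
  then have "ennreal (1 / \<bar>\<alpha>\<bar> ^ CARD('n)) * (ennreal (\<bar>\<alpha>\<bar> ^ CARD('n)) * (\<integral>\<^sup>+x. window k x \<partial>lborel)) \<le>
      ennreal (1 / \<bar>\<alpha>\<bar> ^ CARD('n)) * ennreal K"
    by (intro mult_left_mono) auto
  then show ?thesis
    using \<alpha> K by (simp add: mult.assoc[symmetric] ennreal_mult[symmetric])
qed

lemma sum_window: "AE x in lborel. (\<integral>\<^sup>+k. window k x \<partial>count_space UNIV) \<le> ennreal K"
  using AE_lborel_affine[OF \<alpha> periodization_le, of 0] by simp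

lemma norm_coeff_le: "ennreal (norm (coeff f k)) \<le> (\<integral>\<^sup>+x. ennreal (norm (f x)) * window k x \<partial>lborel)"
  using norm_integral_le_nn_integral[of lborel "\<lambda>x. f x * cnj (\<phi> (\<alpha> *\<^sub>R x - lattice_point k))"]
  by (simp add: coeff_def norm_mult ennreal_mult)

text \<open>Tonelli moves the sum over k inside, where the windows at a point x add up to at most K
  for almost every x.\<close>

lemma sum_nn_integral_window:
  fixes F :: "real^'n \<Rightarrow> ennreal"
  assumes [measurable]: "F \<in> borel_measurable borel"
  shows "(\<integral>\<^sup>+k. (\<integral>\<^sup>+x. F x * window k x \<partial>lborel) \<partial>count_space UNIV) \<le> (\<integral>\<^sup>+x. F x \<partial>lborel) * ennreal K"
proof -
  have "(\<integral>\<^sup>+k. (\<integral>\<^sup>+x. F x * window k x \<partial>lborel) \<partial>count_space UNIV) =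
      (\<integral>\<^sup>+x. (\<integral>\<^sup>+k. F x * window k x \<partial>count_space UNIV) \<partial>lborel)"
    by (rule nn_integral_count_space_nn_integral[symmetric]) auto
  also have "\<dots> = (\<integral>\<^sup>+x. F x * (\<integral>\<^sup>+k. window k x \<partial>count_space UNIV) \<partial>lborel)"
    by (simp add: nn_integral_cmult)
  also have "\<dots> \<le> (\<integral>\<^sup>+x. F x * ennreal K \<partial>lborel)"
    using sum_window by (intro nn_integral_mono_AE) (auto elim!: eventually_mono intro!: mult_left_mono)
  also have "\<dots> = (\<integral>\<^sup>+x. F x \<partial>lborel) * ennreal K"
    by (intro nn_integral_multc) measurable
  finally show ?thesis .
qed

lemma nn_integral_window_infinity:
  assumes "f \<in> borel_measurable borel"
  shows "(\<integral>\<^sup>+x. ennreal (norm (f x)) * window k x \<partial>lborel) \<le>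
    Lp_norm \<infinity> lborel f * ennreal (K / \<bar>\<alpha>\<bar> ^ CARD('n))"
proof -
  have "(\<integral>\<^sup>+x. ennreal (norm (f x)) * window k x \<partial>lborel) \<le> (\<integral>\<^sup>+x. Lp_norm \<infinity> lborel f * window k x \<partial>lborel)"
    unfolding Lp_norm_infinity
    by (intro nn_integral_mono_AE eventually_mono[OF esssup_AE]) (auto intro: mult_right_mono)
  also have "\<dots> = Lp_norm \<infinity> lborel f * (\<integral>\<^sup>+x. window k x \<partial>lborel)"
    by (intro nn_integral_cmult) measurable
  also have "\<dots> \<le> Lp_norm \<infinity> lborel f * ennreal (K / \<bar>\<alpha>\<bar> ^ CARD('n))"
    by (intro mult_left_mono nn_integral_window) auto
  finally show ?thesis .
qed

text \<open>Splitting the integral of a difference requires genuine integrability. For finite p the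
  bound |f| \<le> 1 + |f|^p takes the place of Hoelder's inequality: the window is integrable, and
  |f|^p times the window is controlled by the sum over all k.\<close>

lemma integrable_coeff:
  assumes p: "1 \<le> p" and [measurable]: "f \<in> borel_measurable borel" and fin: "Lp_norm p lborel f < \<infinity>"
  shows "integrable lborel (\<lambda>x. f x * cnj (\<phi> (\<alpha> *\<^sub>R x - lattice_point k)))"
proof (rule integrableI_bounded)
  have "(\<integral>\<^sup>+x. ennreal (norm (f x)) * window k x \<partial>lborel) < \<infinity>"
  proof (cases "p = \<infinity>")
    case True
    have "(\<integral>\<^sup>+x. ennreal (norm (f x)) * window k x \<partial>lborel) \<le>
        Lp_norm \<infinity> lborel f * ennreal (K / \<bar>\<alpha>\<bar> ^ CARD('n))"
      by (rule nn_integral_window_infinity) measurable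
    also have "\<dots> < \<infinity>" using fin True by (simp add: ennreal_mult_less_top)
    finally show ?thesis .
  next
    case False
    define P where "P = enn2real p"
    have P: "P \<ge> 1" using p False by (simp add: P_def enn2real_ge_1)
    have finP: "(\<integral>\<^sup>+x. ennreal (norm (f x) powr P) \<partial>lborel) < \<infinity>"
      using fin False by (auto simp: Lp_norm_def P_def Let_def top.not_eq_extremum split: if_splits)
    have "(\<integral>\<^sup>+x. ennreal (norm (f x)) * window k x \<partial>lborel) \<le>
        (\<integral>\<^sup>+x. window k x + ennreal (norm (f x) powr P) * window k x \<partial>lborel)"
    proof (intro nn_integral_mono)
      fix x
      have "norm (f x) \<le> 1 + norm (f x) powr P"
      proof (cases "norm (f x) \<le> 1")
        case False
        then have "norm (f x) powr 1 \<le> norm (f x) powr P" using P by (intro powr_mono) auto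
        then show ?thesis using False by simp
      qed (simp add: add_increasing2)
      then have "ennreal (norm (f x)) \<le> 1 + ennreal (norm (f x) powr P)"
        by (metis ennreal_1 ennreal_leI ennreal_plus powr_ge_zero zero_le_one)
      then have "ennreal (norm (f x)) * window k x \<le> (1 + ennreal (norm (f x) powr P)) * window k x"
        by (intro mult_right_mono) auto
      then show "ennreal (norm (f x)) * window k x \<le> window k x + ennreal (norm (f x) powr P) * window k x"
        by (simp add: distrib_right)
    qed
    also have "\<dots> = (\<integral>\<^sup>+x. window k x \<partial>lborel) + (\<integral>\<^sup>+x. ennreal (norm (f x) powr P) * window k x \<partial>lborel)"
      by (intro nn_integral_add) measurable
    \<comment> \<open>A single index k is dominated by the sum over all indices.\<close>
    also have "(\<integral>\<^sup>+x. ennreal (norm (f x) powr P) * window k x \<partial>lborel) \<le>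
        (\<integral>\<^sup>+k. (\<integral>\<^sup>+x. ennreal (norm (f x) powr P) * window k x \<partial>lborel) \<partial>count_space UNIV)"
      by (rule nn_integral_ge_point) simp
    also have "\<dots> \<le> (\<integral>\<^sup>+x. ennreal (norm (f x) powr P) \<partial>lborel) * ennreal K"
      by (intro sum_nn_integral_window) measurable
    also have "(\<integral>\<^sup>+x. window k x \<partial>lborel) + (\<integral>\<^sup>+x. ennreal (norm (f x) powr P) \<partial>lborel) * ennreal K < \<infinity>"
      using finP le_less_trans[OF nn_integral_window[of k]] by (simp add: ennreal_mult_less_top)
    finally show ?thesis by (simp add: add_left_mono)
  qed
  then show "(\<integral>\<^sup>+x. ennreal (norm (f x * cnj (\<phi> (\<alpha> *\<^sub>R x - lattice_point k)))) \<partial>lborel) < \<infinity>"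
    by (simp add: norm_mult ennreal_mult)
qed measurable

text \<open>The normalising power makes the dilation disappear. With D = |\<alpha>|^d each window
  has mass at most K/D, so Jensen yields (K/D)^(p-1), and the factor D^(p-1) from the normalisation
  cancels its denominator. Summing over k supplies one more K, which completes K^p. For p =
  \<infinity> the exponent is 1 and the cancellation is D (K/D) = K.\<close>

lemma Lp_norm_coeff:
  assumes p: "1 \<le> p" and [measurable]: "f \<in> borel_measurable borel"
  shows "Lp_norm p (count_space UNIV)
      (\<lambda>k. complex_of_real ((\<bar>\<alpha>\<bar> ^ CARD('n)) powr (1 - enn2real (1 / p))) * coeff f k) \<le>
    ennreal K * Lp_norm p lborel f"
proof (cases "p = \<infinity>")
  case True
  have "ennreal (norm (complex_of_real (\<bar>\<alpha>\<bar> ^ CARD('n)) * coeff f k)) \<le> ennreal K * Lp_norm \<infinity> lborel f" for k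
  proof -
    have "ennreal (norm (complex_of_real (\<bar>\<alpha>\<bar> ^ CARD('n)) * coeff f k)) =
        ennreal (\<bar>\<alpha>\<bar> ^ CARD('n)) * ennreal (norm (coeff f k))"
      by (simp add: norm_mult ennreal_mult norm_power)
    also have "\<dots> \<le> ennreal (\<bar>\<alpha>\<bar> ^ CARD('n)) * (Lp_norm \<infinity> lborel f * ennreal (K / \<bar>\<alpha>\<bar> ^ CARD('n)))"
      by (intro mult_left_mono order.trans[OF norm_coeff_le nn_integral_window_infinity]) auto
    also have "\<dots> = ennreal (\<bar>\<alpha>\<bar> ^ CARD('n) * (K / \<bar>\<alpha>\<bar> ^ CARD('n))) * Lp_norm \<infinity> lborel f"
      using K \<alpha> by (subst ennreal_mult) (auto simp: mult_ac)
    also have "\<bar>\<alpha>\<bar> ^ CARD('n) * (K / \<bar>\<alpha>\<bar> ^ CARD('n)) = K"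
      using \<alpha> by simp
    finally show ?thesis .
  qed
  then show ?thesis
    using \<alpha> unfolding True by (intro Lp_norm_le_infinity) (auto simp: AE_count_space)
next
  case False
  define P where "P = enn2real p"
  have P: "P \<ge> 1" using p False by (simp add: P_def enn2real_ge_1)
  have inv: "enn2real (1 / p) = 1 / P"
    using p False by (cases p) (auto simp: P_def divide_ennreal ennreal_1[symmetric] simp del: ennreal_1)
  define D where "D = \<bar>\<alpha>\<bar> ^ CARD('n)"
  have D: "D > 0" using \<alpha> by (simp add: D_def)
  let ?I = "\<lambda>k. \<integral>\<^sup>+x. ennreal (norm (f x) powr P) * window k x \<partial>lborel"
  have pt: "ennreal (norm (complex_of_real (D powr (1 - 1 / P)) * coeff f k) powr P) \<le> ennreal (K powr (P - 1)) * ?I k" for k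
  proof -
    have "ennreal (norm (coeff f k) powr P) \<le> ?I k * ennreal ((K / D) powr (P - 1))"
    proof (rule nn_integral_weighted_powr[OF P])
      show "(\<integral>\<^sup>+x. window k x \<partial>lborel) \<le> ennreal (K / D)"
        unfolding D_def by (rule nn_integral_window)
    qed (use K D norm_coeff_le in auto)
    then have "ennreal (D powr (P - 1)) * ennreal (norm (coeff f k) powr P) \<le>
        ennreal (D powr (P - 1)) * (?I k * ennreal ((K / D) powr (P - 1)))"
      by (intro mult_left_mono) auto
    also have "\<dots> = ennreal (D powr (P - 1) * (K / D) powr (P - 1)) * ?I k"
      by (simp add: ennreal_mult mult_ac)
    also have "D powr (P - 1) * (K / D) powr (P - 1) = K powr (P - 1)"
      using D K by (simp add: powr_divide)
    also have "ennreal (D powr (P - 1)) * ennreal (norm (coeff f k) powr P) =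
        ennreal (norm (complex_of_real (D powr (1 - 1 / P)) * coeff f k) powr P)"
      using P D by (simp add: norm_mult powr_mult powr_powr left_diff_distrib ennreal_mult)
    finally show ?thesis .
  qed
  have "(\<integral>\<^sup>+k. ennreal (norm (complex_of_real (D powr (1 - 1 / P)) * coeff f k) powr P) \<partial>count_space UNIV) \<le>
      (\<integral>\<^sup>+k. ennreal (K powr (P - 1)) * ?I k \<partial>count_space UNIV)"
    by (intro nn_integral_mono pt)
  also have "\<dots> = ennreal (K powr (P - 1)) * (\<integral>\<^sup>+k. ?I k \<partial>count_space UNIV)"
    by (intro nn_integral_cmult) auto
  also have "\<dots> \<le> ennreal (K powr (P - 1)) * ((\<integral>\<^sup>+x. ennreal (norm (f x) powr P) \<partial>lborel) * ennreal K)"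
    by (intro mult_left_mono sum_nn_integral_window) auto
  also have "\<dots> = ennreal (K powr (P - 1) * K) * (\<integral>\<^sup>+x. ennreal (norm (f x) powr P) \<partial>lborel)"
    using K by (simp add: ennreal_mult mult_ac)
  also have "K powr (P - 1) * K = K powr P"
    using K by (cases "K = 0") (auto simp: powr_diff)
  finally show ?thesis
    unfolding inv D_def[symmetric] using False p K by (intro Lp_norm_le_finite) (auto simp: P_def)
qed

text \<open>Substituting x + e_t/\<alpha> for x in the shifted term leaves f in place and lowers the
  index of the window by e_t. Integrability is part of the conclusion so that the step can be
  iterated.\<close>

lemma coeff_step_diff:
  assumes [measurable]: "f \<in> borel_measurable borel"
    and int: "\<And>k. integrable lborel (\<lambda>x. f x * cnj (\<phi> (\<alpha> *\<^sub>R x - lattice_point k)))"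
  shows "coeff (step_diff (1 / \<alpha>) t f) k = coeff f k - coeff f (k - axis t 1)" (is ?eq)
    and "integrable lborel (\<lambda>x. step_diff (1 / \<alpha>) t f x * cnj (\<phi> (\<alpha> *\<^sub>R x - lattice_point k)))" (is ?int)
proof -
  define v :: "real^'n" where "v = (1 / \<alpha>) *\<^sub>R axis t 1"
  let ?g = "\<lambda>x. f (x - v) * cnj (\<phi> (\<alpha> *\<^sub>R x - lattice_point k))"
  have arg: "\<alpha> *\<^sub>R (x + v) - lattice_point k = \<alpha> *\<^sub>R x - lattice_point (k - axis t 1)" for x
  proof -
    have "\<alpha> *\<^sub>R v = axis t 1" using \<alpha> by (simp add: v_def)
    moreover have "lattice_point (k - axis t 1) = lattice_point k - axis t 1"
      by (simp add: vec_eq_iff lattice_point_def axis_def)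
    ultimately show ?thesis by (simp add: scaleR_add_right)
  qed
  have meas: "?g \<in> borel_measurable borel" by measurable
  have shift: "(LINT x|lborel. ?g x) = coeff f (k - axis t 1)" "integrable lborel ?g"
    using integral_lborel_translate[of ?g v, OF meas] int[of "k - axis t 1"] unfolding arg coeff_def by simp_all
  have eq: "step_diff (1 / \<alpha>) t f x * cnj (\<phi> (\<alpha> *\<^sub>R x - lattice_point k)) =
      f x * cnj (\<phi> (\<alpha> *\<^sub>R x - lattice_point k)) - ?g x" for x
    by (simp add: step_diff_def v_def left_diff_distrib)
  show ?int unfolding eq using int shift(2) by simp
  show ?eq
    using int[of k] shift unfolding coeff_def[of "step_diff (1 / \<alpha>) t f"] eq by (simp add: coeff_def)
qed

text \<open>Integrability for every k accompanies the induction, because each further difference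
  splits one more integral; the scalar c passes through by linearity.\<close>

lemma foldr_seq_diff_coeff:
  assumes f: "f \<in> borel_measurable borel"
    and int: "\<And>k. integrable lborel (\<lambda>x. f x * cnj (\<phi> (\<alpha> *\<^sub>R x - lattice_point k)))"
  shows "foldr seq_diff L (\<lambda>k. c * coeff f k) = (\<lambda>k. c * coeff (foldr (step_diff (1 / \<alpha>)) L f) k)"
proof -
  let ?F = "\<lambda>L. foldr (step_diff (1 / \<alpha>)) L f"
  have F: "?F L \<in> borel_measurable borel \<and>
      (\<forall>k. integrable lborel (\<lambda>x. ?F L x * cnj (\<phi> (\<alpha> *\<^sub>R x - lattice_point k))))" for L
    by (induction L) (auto simp: f int coeff_step_diff)
  show ?thesis
  proof (induction L)
    case (Cons t L)
    then show ?case
      using coeff_step_diff(1)[of "?F L" t] F[of L]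
      by (simp add: seq_diff_def fun_eq_iff right_diff_distrib)
  qed simp
qed

end


section \<open>Passage to Borel representatives and assembly of the estimate\<close>

lemma det_mat_const: "det (mat \<alpha> :: real^'n::finite^'n) = \<alpha> ^ CARD('n)"
  by (subst det_diagonal) (auto simp: mat_def)

lemma mat_const_vector_mult: "(mat \<alpha> :: real^'n::finite^'n) *v x = \<alpha> *\<^sub>R x"
  by (simp add: vec_eq_iff matrix_vector_mult_def mat_def if_distrib[where f="\<lambda>c. c * _"] cong: if_cong)

lemma (in dilated_window) analysis_operator_eq_coeff:
  assumes f: "f \<in> borel_measurable lebesgue" "f' \<in> borel_measurable borel" "AE x in lborel. f x = f' x"
    and \<phi>0: "\<phi>0 \<in> borel_measurable lebesgue" "AE x in lborel. \<phi>0 x = \<phi> x"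
  shows "analysis_operator q (mat \<alpha>) \<phi>0 f =
    (\<lambda>k. complex_of_real ((\<bar>\<alpha>\<bar> ^ CARD('n)) powr enn2real (1 / q)) * coeff f' k)"
proof
  fix k
  let ?c = "complex_of_real ((\<bar>\<alpha>\<bar> ^ CARD('n)) powr enn2real (1 / q))"
  note [measurable] = f(2)
  \<comment> \<open>An invertible affine map pulls null sets back to null sets, so the dilated
    windows also agree almost everywhere.\<close>
  have "AE x in lborel. \<phi>0 (- lattice_point k + \<alpha> *\<^sub>R x) = \<phi> (- lattice_point k + \<alpha> *\<^sub>R x)"
    by (rule AE_lborel_affine[OF \<alpha> \<phi>0(2)])
  then have AE: "AE x in lborel. f x * cnj (?c * \<phi>0 (\<alpha> *\<^sub>R x - lattice_point k)) =
      ?c * (f' x * cnj (\<phi> (\<alpha> *\<^sub>R x - lattice_point k)))"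
    using f(3) by eventually_elim simp
  have bm: "(\<lambda>x. ?c * (f' x * cnj (\<phi> (\<alpha> *\<^sub>R x - lattice_point k)))) \<in> borel_measurable borel"
    by measurable
  \<comment> \<open>Measurability of the dilated original is taken from the Borel function it agrees
    with almost everywhere, by completeness of Lebesgue measure.\<close>
  have "(\<lambda>x. f x * cnj (?c * \<phi>0 (\<alpha> *\<^sub>R x - lattice_point k))) \<in> borel_measurable lebesgue"
  proof (rule borel_measurable_AE)
    show "(\<lambda>x. ?c * (f' x * cnj (\<phi> (\<alpha> *\<^sub>R x - lattice_point k)))) \<in> borel_measurable lebesgue"
      using bm by (intro measurable_completion) simp
    show "AE x in lebesgue. ?c * (f' x * cnj (\<phi> (\<alpha> *\<^sub>R x - lattice_point k))) =
        f x * cnj (?c * \<phi>0 (\<alpha> *\<^sub>R x - lattice_point k))"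
      by (rule AE_completion, rule eventually_mono[OF AE]) auto
  qed
  then have "(LINT x|lebesgue. f x * cnj (?c * \<phi>0 (\<alpha> *\<^sub>R x - lattice_point k))) =
      (LINT x|lborel. ?c * (f' x * cnj (\<phi> (\<alpha> *\<^sub>R x - lattice_point k))))"
    by (rule integral_lebesgue_eq_lborel[OF _ bm AE])
  then show "analysis_operator q (mat \<alpha>) \<phi>0 f k = ?c * coeff f' k"
    by (simp add: analysis_operator_def dilate_translate_def det_mat_const mat_const_vector_mult power_abs coeff_def)
qed

text \<open>The endpoints require no cases, since 1 / \<infinity> = 0 in \<open>ennreal\<close>.
  Both reciprocals are finite as summands of 1, so \<open>enn2real\<close> is additive on
  them.\<close>

lemma conjugate_exponent:
  fixes p q :: ennreal
  assumes "1 \<le> p" "1 / p + 1 / q = 1"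
  shows "enn2real (1 / q) = 1 - enn2real (1 / p)"
proof -
  have "1 / p < \<infinity>" "1 / q < \<infinity>"
    using assms(2) by (metis ennreal_add_eq_top ennreal_one_neq_top infinity_ennreal_def top.not_eq_extremum)+
  then have "enn2real (1 / p + 1 / q) = enn2real (1 / p) + enn2real (1 / q)"
    by (intro enn2real_plus) auto
  then show ?thesis
    using assms(2) by simp
qed

lemma has_weak_deriv_lborel:
  fixes f g f' g' :: "real^'n::{finite,linorder} \<Rightarrow> complex"
  assumes weak: "has_weak_deriv f \<rho> g"
    and f: "f \<in> borel_measurable lebesgue" "f' \<in> borel_measurable borel" "AE x in lborel. f x = f' x"
    and g: "g \<in> borel_measurable lebesgue" "g' \<in> borel_measurable borel" "AE x in lborel. g x = g' x"
    and \<psi>: "test_function \<psi>"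
  shows "(LINT x|lborel. f' x * multi_power partial_deriv \<rho> \<psi> x) = (-1) ^ multi_order \<rho> * (LINT x|lborel. g' x * \<psi> x)"
proof -
  have pairing: "(LINT x|lebesgue. u x * \<theta> x) = (LINT x|lborel. u' x * \<theta> x)"
    if u: "u \<in> borel_measurable lebesgue" "u' \<in> borel_measurable borel" "AE x in lborel. u x = u' x"
      and \<theta>: "smooth \<theta>" for u u' \<theta> :: "real^'n::_ \<Rightarrow> complex"
  proof (rule integral_lebesgue_eq_lborel)
    have \<theta>b: "\<theta> \<in> borel_measurable borel"
      by (intro borel_measurable_continuous_onI smooth_continuous \<theta>)
    have "\<theta> \<in> borel_measurable lborel" using \<theta>b by simp
    then have "\<theta> \<in> borel_measurable lebesgue" by (rule measurable_completion)
    then show "(\<lambda>x. u x * \<theta> x) \<in> borel_measurable lebesgue"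
      using u(1) by (rule borel_measurable_times[rotated])
    show "(\<lambda>x. u' x * \<theta> x) \<in> borel_measurable borel"
      using u(2) \<theta>b by (rule borel_measurable_times)
    show "AE x in lborel. u x * \<theta> x = u' x * \<theta> x"
      using u(3) by eventually_elim simp
  qed
  have s: "smooth \<psi>" using \<psi> by (simp add: test_function_def)
  then have s': "smooth (multi_power partial_deriv \<rho> \<psi>)"
    unfolding multi_power_eq_foldr by (rule smooth_foldr_partial_deriv)
  have "(LINT x|lebesgue. f x * multi_power partial_deriv \<rho> \<psi> x) =
      (-1) ^ multi_order \<rho> * (LINT x|lebesgue. g x * \<psi> x)"
    using weak \<psi> unfolding has_weak_deriv_def by blast
  then show ?thesis
    unfolding pairing[OF f s'] pairing[OF g s] .
qed

text \<open>The estimate already holds for each multiindex separately and with the same K: the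
  factor |1/\<alpha>|^|\<rho>| of the averaged derivative meets the weight
  |\<alpha>|^|\<rho>|.\<close>

lemma Lp_norm_diff_analysis_operator:
  fixes p q :: ennreal and f g \<phi> \<phi>0 :: "real^'n::{finite,linorder} \<Rightarrow> complex"
  assumes window: "dilated_window \<alpha> \<phi> K"
    and p: "1 \<le> p" and pq: "1 / p + 1 / q = 1"
    and \<phi>0: "\<phi>0 \<in> borel_measurable lebesgue" "AE x in lborel. \<phi>0 x = \<phi> x"
    and f: "f \<in> Lp_space p lebesgue" and weak: "has_weak_deriv f \<rho> g" and g: "g \<in> Lp_space p lebesgue"
  shows "ennreal (\<bar>\<alpha>\<bar> ^ multi_order \<rho>) *
      Lp_norm p (count_space UNIV) (multi_power seq_diff \<rho> (analysis_operator q (mat \<alpha>) \<phi>0 f)) \<le>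
    ennreal K * Lp_norm p lebesgue g"
proof -
  interpret dilated_window \<alpha> \<phi> K by (rule window)
  have f0: "f \<in> borel_measurable lebesgue" and g0: "g \<in> borel_measurable lebesgue"
    using f g by (auto simp: Lp_space_def)
  obtain f' where f': "f' \<in> borel_measurable borel" "AE x in lborel. f x = f' x"
    using lebesgue_borel_representative[OF f0] by blast
  obtain g' where g': "g' \<in> borel_measurable borel" "AE x in lborel. g x = g' x"
    using lebesgue_borel_representative[OF g0] by blast
  have Lf: "locally_L1 f'" and Lg: "locally_L1 g'"
    using weak unfolding has_weak_deriv_def
    by (auto intro: locally_L1_representative[OF _ f'] locally_L1_representative[OF _ g'])
  define L where "L = index_list \<rho>"
  have len: "length L = multi_order \<rho>"
    unfolding L_def by (rule length_index_list)
  define F where "F = fold (step_diff (1 / \<alpha>)) L f'"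
  define G where "G = fold (step_avg (1 / \<alpha>)) L g'"
  have G: "G \<in> borel_measurable borel" unfolding G_def using g' by measurable
  have F: "F \<in> borel_measurable borel"
    using locally_L1_fold(1)[OF Lf] unfolding F_def locally_L1_def by blast
  have FG: "AE x in lborel. F x = complex_of_real (1 / \<alpha>) ^ length L * G x"
    unfolding F_def G_def
  proof (rule AE_step_diff_eq_step_avg[OF Lf Lg])
    fix \<psi> :: "real^'n::_ \<Rightarrow> complex"
    assume "test_function \<psi>"
    then show "(LINT x|lborel. f' x * foldr partial_deriv L \<psi> x) = (-1) ^ length L * (LINT x|lborel. g' x * \<psi> x)"
      using has_weak_deriv_lborel[OF weak f0 f' g0 g']
      by (simp add: multi_power_eq_foldr L_def length_index_list)
  qed
  have fin: "Lp_norm p lborel f' < \<infinity>"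
    using f Lp_norm_lebesgue_eq_lborel[OF f0 f'] by (simp add: Lp_space_def)
  have "multi_power seq_diff \<rho> (analysis_operator q (mat \<alpha>) \<phi>0 f) =
      (\<lambda>k. complex_of_real ((\<bar>\<alpha>\<bar> ^ CARD('n)) powr (1 - enn2real (1 / p))) * coeff F k)"
    unfolding analysis_operator_eq_coeff[OF f0 f' \<phi>0] multi_power_eq_foldr L_def[symmetric] F_def
      foldr_step_diff_eq_fold[symmetric] conjugate_exponent[OF p pq]
    by (rule foldr_seq_diff_coeff[OF f'(1) integrable_coeff[OF p f'(1) fin]])
  then have "Lp_norm p (count_space UNIV) (multi_power seq_diff \<rho> (analysis_operator q (mat \<alpha>) \<phi>0 f)) \<le>
      ennreal K * Lp_norm p lborel F"
    using Lp_norm_coeff[OF p F] by simp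
  also have "Lp_norm p lborel F = Lp_norm p lborel (\<lambda>x. complex_of_real (1 / \<alpha>) ^ length L * G x)"
    using F G FG by (intro Lp_norm_cong_AE) auto
  also have "\<dots> \<le> ennreal (norm (complex_of_real (1 / \<alpha>) ^ length L)) * Lp_norm p lborel G"
    using G by (intro Lp_norm_cmult_le p) auto
  also have "Lp_norm p lborel G \<le> Lp_norm p lborel g'"
    unfolding G_def by (rule Lp_norm_fold_step_avg[OF p g'(1)])
  also have "\<dots> = Lp_norm p lebesgue g"
    by (rule Lp_norm_lebesgue_eq_lborel[OF g0 g', symmetric])
  finally have "ennreal (\<bar>\<alpha>\<bar> ^ multi_order \<rho>) *
      Lp_norm p (count_space UNIV) (multi_power seq_diff \<rho> (analysis_operator q (mat \<alpha>) \<phi>0 f)) \<le>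
    ennreal (\<bar>\<alpha>\<bar> ^ multi_order \<rho>) * (ennreal K *
      (ennreal (norm (complex_of_real (1 / \<alpha>) ^ length L)) * Lp_norm p lebesgue g))"
    by (simp add: mult_left_mono)
  also have "\<dots> = ennreal (\<bar>\<alpha>\<bar> ^ multi_order \<rho> * norm (complex_of_real (1 / \<alpha>) ^ length L)) *
      (ennreal K * Lp_norm p lebesgue g)"
    by (subst ennreal_mult) (auto simp: mult_ac)
  also have "\<bar>\<alpha>\<bar> ^ multi_order \<rho> * norm (complex_of_real (1 / \<alpha>) ^ length L) = 1"
    using \<alpha> by (simp add: len norm_power norm_divide power_one_over)
  finally show ?thesis by simp
qed

theorem proposition23:
  fixes p q :: ennreal and m j :: nat and \<alpha> :: "nat \<Rightarrow> real"
    and a :: "nat \<Rightarrow> real^'n::_^'n::{finite,linorder}"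
    and \<phi> :: "real^'n::_ \<Rightarrow> complex"
  assumes "\<And>i. i \<ge> 1 \<Longrightarrow> \<alpha> i \<noteq> 0"
    and "filterlim (\<lambda>i. \<bar>\<alpha> i\<bar>) at_top sequentially"
    and "\<And>i. i \<ge> 1 \<Longrightarrow> a i = mat (\<alpha> i)"
    and "1 \<le> p" and "1 / p + 1 / q = 1"
    and "\<phi> \<in> Lp_space q lebesgue"
    and "periodization (\<lambda>x. ennreal (norm (\<phi> x))) \<in> borel_measurable lebesgue"
    and "esssup lebesgue (periodization (\<lambda>x. ennreal (norm (\<phi> x)))) < \<infinity>"
    and "j > 0"
  shows "analysis_operator q (a j) \<phi> \<in> sobolev_space m p \<rightarrow> discrete_sobolev_space m p \<and>
    (\<forall>f \<in> sobolev_space m p.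
      (\<Sum>\<rho> | multi_order \<rho> \<le> m.
          ennreal (\<bar>\<alpha> j\<bar> ^ multi_order \<rho>) *
          Lp_norm p (count_space UNIV) (multi_power seq_diff \<rho> (analysis_operator q (a j) \<phi> f)))
      \<le> esssup lebesgue (periodization (\<lambda>x. ennreal (norm (\<phi> x)))) * sobolev_norm m p f)"
proof -
  let ?E = "esssup lebesgue (periodization (\<lambda>x. ennreal (norm (\<phi> x))))"
  let ?T = "analysis_operator q (a j) \<phi>"
  have a: "a j = mat (\<alpha> j)" and \<alpha>: "\<alpha> j \<noteq> 0" using assms by auto
  have \<phi>0: "\<phi> \<in> borel_measurable lebesgue" using assms by (simp add: Lp_space_def)
  obtain \<phi>' where \<phi>': "\<phi>' \<in> borel_measurable borel" "AE x in lborel. \<phi> x = \<phi>' x"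
    using lebesgue_borel_representative[OF \<phi>0] by blast
  define K where "K = enn2real ?E"
  have K: "?E = ennreal K" "0 \<le> K" using assms(8) by (simp_all add: K_def)
  have "AE x in lborel. periodization (\<lambda>x. ennreal (norm (\<phi> x))) x \<le> ?E"
    using esssup_AE[of "periodization (\<lambda>x. ennreal (norm (\<phi> x)))" lebesgue] by (simp add: AE_completion_iff)
  \<comment> \<open>One null set serves all k at once because the lattice is countable.\<close>
  moreover have "AE x in lborel. \<forall>k. \<phi> (x - lattice_point k) = \<phi>' (x - lattice_point k)"
    unfolding AE_all_countable
  proof
    fix k
    show "AE x in lborel. \<phi> (x - lattice_point k) = \<phi>' (x - lattice_point k)"
      using AE_lborel_affine[OF _ \<phi>'(2), of 1 "- lattice_point k"] by simp
  qed
  ultimately have "AE x in lborel. (\<integral>\<^sup>+k. ennreal (norm (\<phi>' (x - lattice_point k))) \<partial>count_space UNIV) \<le> ennreal K"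
  proof eventually_elim
    case (elim x)
    have "(\<integral>\<^sup>+k. ennreal (norm (\<phi>' (x - lattice_point k))) \<partial>count_space UNIV) \<le>
        periodization (\<lambda>x. ennreal (norm (\<phi> x))) x"
      unfolding periodization_def using nn_integral_count_space_le_infsum elim(2) by simp
    then show ?case using elim(1) K by simp
  qed
  then have window: "dilated_window (\<alpha> j) \<phi>' K"
    by unfold_locales (use \<alpha> \<phi>' K in auto)
  have bound: "ennreal (\<bar>\<alpha> j\<bar> ^ multi_order \<rho>) * Lp_norm p (count_space UNIV) (multi_power seq_diff \<rho> (?T f)) \<le>
      ennreal K * Lp_norm p lebesgue (weak_deriv \<rho> f)"
    and fin: "Lp_norm p lebesgue (weak_deriv \<rho> f) < \<infinity>"
    if f: "f \<in> sobolev_space m p" and \<rho>: "multi_order \<rho> \<le> m" for f \<rho>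
  proof -
    have "f \<in> Lp_space p lebesgue" "\<exists>g. has_weak_deriv f \<rho> g" and w: "weak_deriv \<rho> f \<in> Lp_space p lebesgue"
      using f \<rho> unfolding sobolev_space_def by auto
    \<comment> \<open>Existence of some weak derivative makes the one selected by
      \<open>weak_deriv\<close> a weak derivative as well.\<close>
    moreover from this(2) have "has_weak_deriv f \<rho> (weak_deriv \<rho> f)"
      unfolding weak_deriv_def by (rule someI_ex)
    ultimately show "ennreal (\<bar>\<alpha> j\<bar> ^ multi_order \<rho>) * Lp_norm p (count_space UNIV) (multi_power seq_diff \<rho> (?T f)) \<le>
        ennreal K * Lp_norm p lebesgue (weak_deriv \<rho> f)"
      unfolding a by (intro Lp_norm_diff_analysis_operator[OF window] assms \<phi>0 \<phi>')
    show "Lp_norm p lebesgue (weak_deriv \<rho> f) < \<infinity>"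
      using w by (simp add: Lp_space_def)
  qed
  have mem: "multi_power seq_diff \<rho> (?T f) \<in> Lp_space p (count_space UNIV)"
    if "f \<in> sobolev_space m p" "multi_order \<rho> \<le> m" for f \<rho>
  proof -
    have "ennreal K * Lp_norm p lebesgue (weak_deriv \<rho> f) < \<infinity>"
      using fin[OF that] by (simp add: ennreal_mult_less_top)
    then have "ennreal (\<bar>\<alpha> j\<bar> ^ multi_order \<rho>) * Lp_norm p (count_space UNIV) (multi_power seq_diff \<rho> (?T f)) < \<infinity>"
      using bound[OF that] by order
    \<comment> \<open>\<alpha> j is nonzero, so the weight is a positive factor and finiteness
      passes to the norm itself.\<close>
    then show ?thesis
      using \<alpha> by (auto simp: Lp_space_def ennreal_mult_less_top)
  qed
  have "?T f \<in> discrete_sobolev_space m p" if "f \<in> sobolev_space m p" for f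
  proof -
    \<comment> \<open>The zero multiindex gives the membership of the sequence itself in the space
      of p-summable (for p = \<infinity>, bounded) sequences.\<close>
    have "index_list (\<lambda>_::'n. 0) = []"
      using length_index_list[of "\<lambda>_::'n. 0"] by (simp add: multi_order_def)
    then have "multi_power seq_diff (\<lambda>_::'n. 0) (?T f) = ?T f"
      by (simp add: multi_power_eq_foldr)
    then have "?T f \<in> Lp_space p (count_space UNIV)"
      using mem[OF that, of "\<lambda>_. 0"] by (simp add: multi_order_def)
    then show ?thesis
      using mem[OF that] by (simp add: discrete_sobolev_space_def)
  qed
  moreover have "(\<Sum>\<rho> | multi_order \<rho> \<le> m. ennreal (\<bar>\<alpha> j\<bar> ^ multi_order \<rho>) *
          Lp_norm p (count_space UNIV) (multi_power seq_diff \<rho> (?T f))) \<le> ?E * sobolev_norm m p f"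
    if "f \<in> sobolev_space m p" for f
    unfolding sobolev_norm_def sum_distrib_left K(1) by (intro sum_mono bound that) simp
  ultimately show ?thesis by blast
qed

end
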